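(* Let $1\le p<\infty$. Suppose that $\{f_n,g_n\}_{n=1}^\infty$ is an unconditional quasibasic sequence in $L_p(0,1)$ and that each $f_n$ is non-negative. Then the closed linear span $[f_n]$ of $\{f_n\}_{n=1}^\infty$ in $L_p(0,1)$ embeds isomorphically into $\ell_p$ (that is, there is a linear map from $[f_n]$ into $\ell_p$ that is a homeomorphism onto its image).
   Context: $L_p(0,1)$ is taken with respect to Lebesgue measure; non-negative means non-negative almost everywhere. A quasibasis for a Banach space $X$ is a sequence $\{f_n,g_n\}_{n=1}^\infty$ in $X\times X^*$ such that for each $x\in X$ the series $\sum_n\langle g_n,x\rangle f_n$ converges in norm to $x$. The quasibasis is unconditional if for each $x\in X$ the series $\sum_n\langle g_n,x\rangle f_n$ converges unconditionally to $x$. For a Banach space $X$, a sequence $\{f_n,g_n\}_{n=1}^\infty$ in $X\times X^*$ is called unconditionally quasibasic (an unconditional quasibasic sequence in $X$) if $\{f_n,h_n\}_{n=1}^\infty$ is an unconditional quasibasis for the closed linear span $[f_n]$ of $\{f_n\}_{n=1}^\infty$, where $h_n$ is the restriction of $g_n$ to $[f_n]$. Here $X=L_p(0,1)$. *)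

theory Defs
  imports "HOL-Analysis.Analysis" "HOL-Library.Nonpos_Ints"
begin

text \<open>
  The scalar field is a type of class \<open>{real_normed_field, euclidean_space}\<close>, which covers the
  real and the complex numbers.  Normed spaces are given by a carrier \<open>V\<close> of scalar-valued
  functions with pointwise operations and a seminorm \<open>N\<close> on it.  Elements of \<open>L\<^sub>p\<close> are represented
  by functions, two of which represent the same element if their difference has seminorm 0; all
  notions below are invariant under this identification.
\<close>

definition Lp :: "real \<Rightarrow> (real \<Rightarrow> 'k::{real_normed_field,euclidean_space}) set" where
  "Lp p = {x \<in> borel_measurable (lebesgue_on {0<..<1}).
             integrable (lebesgue_on {0<..<1}) (\<lambda>t. norm (x t) powr p)}"

definition Lp_norm :: "real \<Rightarrow> (real \<Rightarrow> 'k::{real_normed_field,euclidean_space}) \<Rightarrow> real" where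
  "Lp_norm p x = (\<integral>t. norm (x t) powr p \<partial>lebesgue_on {0<..<1}) powr (1 / p)"

definition seq_lp :: "real \<Rightarrow> (nat \<Rightarrow> 'k::{real_normed_field,euclidean_space}) set" where
  "seq_lp p = {a. summable (\<lambda>n. norm (a n) powr p)}"

definition seq_lp_norm :: "real \<Rightarrow> (nat \<Rightarrow> 'k::{real_normed_field,euclidean_space}) \<Rightarrow> real" where
  "seq_lp_norm p a = (\<Sum>n. norm (a n) powr p) powr (1 / p)"

definition dual_space ::
    "('a \<Rightarrow> 'k::{real_normed_field,euclidean_space}) set \<Rightarrow> (('a \<Rightarrow> 'k) \<Rightarrow> real)
      \<Rightarrow> (('a \<Rightarrow> 'k) \<Rightarrow> 'k) set" where
  "dual_space V N = {g.
     (\<forall>x\<in>V. \<forall>y\<in>V. g (\<lambda>t. x t + y t) = g x + g y) \<and>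
     (\<forall>c. \<forall>x\<in>V. g (\<lambda>t. c * x t) = c * g x) \<and>
     (\<exists>C. \<forall>x\<in>V. norm (g x) \<le> C * N x)}"

definition lin_span ::
    "(nat \<Rightarrow> 'a \<Rightarrow> 'k::{real_normed_field,euclidean_space}) \<Rightarrow> ('a \<Rightarrow> 'k) set" where
  "lin_span f = {\<lambda>t. \<Sum>k<n. c k * f k t | n c. True}"

definition closed_span ::
    "('a \<Rightarrow> 'k::{real_normed_field,euclidean_space}) set \<Rightarrow> (('a \<Rightarrow> 'k) \<Rightarrow> real)
      \<Rightarrow> (nat \<Rightarrow> 'a \<Rightarrow> 'k) \<Rightarrow> ('a \<Rightarrow> 'k) set" where
  "closed_span V N f = {x \<in> V. \<forall>e>0. \<exists>y\<in>lin_span f. N (\<lambda>t. x t - y t) < e}"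

definition series_converges_to ::
    "(('a \<Rightarrow> 'k::{real_normed_field,euclidean_space}) \<Rightarrow> real)
      \<Rightarrow> (nat \<Rightarrow> 'a \<Rightarrow> 'k) \<Rightarrow> ('a \<Rightarrow> 'k) \<Rightarrow> bool" where
  "series_converges_to N u x \<longleftrightarrow> (\<lambda>n. N (\<lambda>t. (\<Sum>k<n. u k t) - x t)) \<longlonglongrightarrow> 0"

definition series_converges_unconditionally_to ::
    "(('a \<Rightarrow> 'k::{real_normed_field,euclidean_space}) \<Rightarrow> real)
      \<Rightarrow> (nat \<Rightarrow> 'a \<Rightarrow> 'k) \<Rightarrow> ('a \<Rightarrow> 'k) \<Rightarrow> bool" where
  "series_converges_unconditionally_to N u x \<longleftrightarrow>
     (\<forall>\<pi>. bij \<pi> \<longrightarrow> series_converges_to N (u \<circ> \<pi>) x)"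

definition quasibasis ::
    "('a \<Rightarrow> 'k::{real_normed_field,euclidean_space}) set \<Rightarrow> (('a \<Rightarrow> 'k) \<Rightarrow> real)
      \<Rightarrow> (nat \<Rightarrow> 'a \<Rightarrow> 'k) \<Rightarrow> (nat \<Rightarrow> ('a \<Rightarrow> 'k) \<Rightarrow> 'k) \<Rightarrow> bool" where
  "quasibasis V N f g \<longleftrightarrow>
     (\<forall>n. f n \<in> V \<and> g n \<in> dual_space V N) \<and>
     (\<forall>x\<in>V. series_converges_to N (\<lambda>n t. g n x * f n t) x)"

definition unconditional_quasibasis ::
    "('a \<Rightarrow> 'k::{real_normed_field,euclidean_space}) set \<Rightarrow> (('a \<Rightarrow> 'k) \<Rightarrow> real)
      \<Rightarrow> (nat \<Rightarrow> 'a \<Rightarrow> 'k) \<Rightarrow> (nat \<Rightarrow> ('a \<Rightarrow> 'k) \<Rightarrow> 'k) \<Rightarrow> bool" where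
  "unconditional_quasibasis V N f g \<longleftrightarrow>
     quasibasis V N f g \<and>
     (\<forall>x\<in>V. series_converges_unconditionally_to N (\<lambda>n t. g n x * f n t) x)"

definition unconditionally_quasibasic ::
    "('a \<Rightarrow> 'k::{real_normed_field,euclidean_space}) set \<Rightarrow> (('a \<Rightarrow> 'k) \<Rightarrow> real)
      \<Rightarrow> (nat \<Rightarrow> 'a \<Rightarrow> 'k) \<Rightarrow> (nat \<Rightarrow> ('a \<Rightarrow> 'k) \<Rightarrow> 'k) \<Rightarrow> bool" where
  "unconditionally_quasibasic V N f g \<longleftrightarrow>
     (\<forall>n. f n \<in> V \<and> g n \<in> dual_space V N) \<and>
     unconditional_quasibasis (closed_span V N f) N f
       (\<lambda>n. restrict (g n) (closed_span V N f))"

text \<open>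
  The last two conjuncts say that \<open>T\<close> is continuous and that it has a continuous inverse on its
  image.  At the level of representatives they also say that \<open>T\<close> is well defined and injective
  modulo seminorm 0: \<open>N (x - y) = 0\<close> if and only if \<open>N' (T x - T y) = 0\<close>.
\<close>

definition isomorphic_embedding ::
    "('a \<Rightarrow> 'k::{real_normed_field,euclidean_space}) set \<Rightarrow> (('a \<Rightarrow> 'k) \<Rightarrow> real)
      \<Rightarrow> ('b \<Rightarrow> 'k) set \<Rightarrow> (('b \<Rightarrow> 'k) \<Rightarrow> real) \<Rightarrow> (('a \<Rightarrow> 'k) \<Rightarrow> ('b \<Rightarrow> 'k)) \<Rightarrow> bool" where
  "isomorphic_embedding V N W N' T \<longleftrightarrow>
     T ` V \<subseteq> W \<and>
     (\<forall>x\<in>V. \<forall>y\<in>V. T (\<lambda>t. x t + y t) = (\<lambda>s. T x s + T y s)) \<and>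
     (\<forall>c. \<forall>x\<in>V. T (\<lambda>t. c * x t) = (\<lambda>s. c * T x s)) \<and>
     (\<forall>x\<in>V. \<forall>e>0. \<exists>d>0. \<forall>y\<in>V. N (\<lambda>t. y t - x t) < d \<longrightarrow> N' (\<lambda>s. T y s - T x s) < e) \<and>
     (\<forall>x\<in>V. \<forall>e>0. \<exists>d>0. \<forall>y\<in>V. N' (\<lambda>s. T y s - T x s) < d \<longrightarrow> N (\<lambda>t. y t - x t) < e)"

end

theory Submission
  imports Defs
begin

text \<open>
  Let \<open>X = [f\<^sub>n]\<close> and write \<open>a\<^sub>n = g\<^sub>n(x)\<close> for \<open>x\<close> in \<open>X\<close>.  Because the \<open>f\<^sub>n\<close> are non-negative,
  unconditional convergence and uniform boundedness give a constant \<open>K\<close> with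
  \<open>\<parallel>\<Sum> |a\<^sub>n| f\<^sub>n\<parallel> \<le> K \<parallel>x\<parallel>\<close> (\<open>modulus_sum_bound\<close>).  Cut the index set into consecutive blocks and let
  \<open>v\<^sub>k\<close> be the part of the expansion in the block \<open>k\<close>.  As \<open>(a + b)\<^sup>p \<ge> a\<^sup>p + b\<^sup>p\<close> for \<open>a, b \<ge> 0\<close>, every
  choice of blocks satisfies \<open>\<Sum> \<parallel>v\<^sub>k\<parallel>\<^sup>p \<le> K\<^sup>p \<parallel>x\<parallel>\<^sup>p\<close> (\<open>block_upper_bound\<close>).

  The converse estimate \<open>\<parallel>x\<parallel>\<^sup>p \<le> C \<Sum> \<parallel>v\<^sub>k\<parallel>\<^sup>p\<close> is trivial for \<open>p = 1\<close>.  For \<open>p > 1\<close> it needs blocks that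
  are almost disjoint as functions.  The operator \<open>x \<mapsto> (a\<^sub>n \<parallel>f\<^sub>n\<parallel>\<^sub>1)\<^sub>n\<close> from \<open>X\<close> into \<open>\<ell>\<^sub>1\<close> is bounded, and since
  \<open>L\<^sub>p\<close> satisfies Clarkson's inequality while \<open>\<ell>\<^sub>1\<close> behaves additively on disjoint supports, its tails
  are uniformly small on the unit ball (\<open>weighted_tails_small\<close>).  A non-negative function with small
  integral has small minimum, in \<open>L\<^sub>p\<close>, with any fixed function in \<open>L\<^sub>p\<close> (\<open>Lp_norm_min_small\<close>).  So
  the blocks can be chosen inductively such that \<open>|v\<^sub>k|\<close> and \<open>\<Sum>\<^bsub>j < k - 1\<^esub> |v\<^sub>j|\<close> overlap very little,
  uniformly in \<open>x\<close> (\<open>blocks_exist\<close>), and then \<open>\<Sum> |v\<^sub>k|\<close> is at most \<open>2 max |v\<^sub>k|\<close> up to a small error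
  (\<open>block_lower_bound\<close>).

  Consequently \<open>x \<mapsto> (v\<^sub>k)\<^sub>k\<close> embeds \<open>X\<close> into the \<open>\<ell>\<^sub>p\<close> sum of the finite-dimensional spaces spanned by
  the blocks.  Replacing the \<open>f\<^sub>n\<close> in the definition of \<open>v\<^sub>k\<close> by simple functions below them changes
  neither estimate essentially, and turns each of these spaces into a subspace of a finite-dimensional
  \<open>\<ell>\<^sub>p\<close> (\<open>embeds_into_seq_lp\<close>).
\<close>

section \<open>Elementary inequalities for powers\<close>

lemma powr_convex_nonneg:
  fixes s t \<theta> p :: real
  assumes "1 \<le> p" "0 \<le> s" "0 \<le> t" "0 \<le> \<theta>" "\<theta> \<le> 1"
  shows "((1 - \<theta>) * s + \<theta> * t) powr p \<le> (1 - \<theta>) * s powr p + \<theta> * t powr p"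
proof -
  have shrink: "(c * u) powr p \<le> c * u powr p" if "0 \<le> c" "c \<le> 1" "0 \<le> u" for c u :: real
  proof -
    have "c powr p \<le> c"
      using powr_mono'[of 1 p c] that \<open>1 \<le> p\<close> by simp
    then show ?thesis
      using that by (simp add: powr_mult mult_right_mono)
  qed
  consider "s = 0" | "t = 0" | "0 < s" "0 < t"
    using assms by linarith
  then show ?thesis
  proof cases
    case 1
    then show ?thesis using shrink[of \<theta> t] assms by simp
  next
    case 2
    then show ?thesis using shrink[of "1 - \<theta>" s] assms by simp
  next
    case 3
    then show ?thesis
      using convex_onD[OF powr_convex[OF \<open>1 \<le> p\<close>], of \<theta> s t] assms by simp
  qed
qed

lemma powr_sum_two_le:
  fixes s t p :: real
  assumes "1 \<le> p" "0 \<le> s" "0 \<le> t"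
  shows "(s + t) powr p \<le> 2 powr (p - 1) * (s powr p + t powr p)"
proof -
  have "((s + t) / 2) powr p \<le> (s powr p + t powr p) / 2"
    using powr_convex_nonneg[of p s t "1/2"] assms by (simp add: field_simps)
  then have "2 powr p * ((s + t) / 2) powr p \<le> 2 powr p * ((s powr p + t powr p) / 2)"
    by (intro mult_left_mono) auto
  also have "2 powr p * ((s + t) / 2) powr p = (2 * ((s + t) / 2)) powr p"
    by (rule powr_mult[symmetric])
  also have "2 * ((s + t) / 2) = s + t"
    by simp
  finally show ?thesis
    by (simp add: powr_diff)
qed

lemma powr_superadditive:
  fixes s t p :: real
  assumes "1 \<le> p" "0 \<le> s" "0 \<le> t"
  shows "s powr p + t powr p \<le> (s + t) powr p"
proof (cases "s = 0 \<or> t = 0")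
  case True
  then show ?thesis by auto
next
  case False
  then have pos: "0 < s" "0 < t" using assms by auto
  have *: "u powr p = u * u powr (p - 1)" if "0 < u" for u
    using powr_add[of u 1 "p - 1"] that by simp
  have "s powr p + t powr p = s * s powr (p - 1) + t * t powr (p - 1)"
    using pos by (simp add: *)
  also have "\<dots> \<le> s * (s + t) powr (p - 1) + t * (s + t) powr (p - 1)"
    using assms by (intro add_mono mult_left_mono powr_mono2) auto
  also have "\<dots> = (s + t) powr p"
    using pos by (simp add: *[of "s + t"] algebra_simps)
  finally show ?thesis .
qed

lemma sum_powr_le_powr_sum:
  fixes u :: "'i \<Rightarrow> real"
  assumes "1 \<le> p" "finite A" "\<And>i. i \<in> A \<Longrightarrow> 0 \<le> u i"
  shows "(\<Sum>i\<in>A. u i powr p) \<le> (\<Sum>i\<in>A. u i) powr p"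
  using assms(2,3)
proof (induction A rule: finite_induct)
  case empty
  then show ?case by simp
next
  case (insert a A)
  then show ?case
    using powr_superadditive[OF \<open>1 \<le> p\<close>, of "u a" "\<Sum>i\<in>A. u i"]
    by (simp add: sum_nonneg)
qed

lemma le_powr_inverse_iff:
  fixes a b p :: real
  assumes "0 < p" "0 \<le> a" "0 \<le> b"
  shows "a powr (1 / p) \<le> b \<longleftrightarrow> a \<le> b powr p"
proof
  assume "a powr (1 / p) \<le> b"
  then have "(a powr (1 / p)) powr p \<le> b powr p"
    using assms by (intro powr_mono2) auto
  then show "a \<le> b powr p"
    using assms by (simp add: powr_powr)
next
  assume "a \<le> b powr p"
  then have "a powr (1 / p) \<le> (b powr p) powr (1 / p)"
    using assms by (intro powr_mono2) auto
  then show "a powr (1 / p) \<le> b"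
    using assms by (simp add: powr_powr)
qed

definition clarkson_const :: "real \<Rightarrow> real" where
  "clarkson_const p = max 1 (2 powr (p - 2))"

text \<open>
  A form of Clarkson's inequality.  It follows from the parallelogram law by comparing the \<open>p\<close>-th
  powers with the power \<open>p / 2\<close> of the squares, which is concave for \<open>p \<le> 2\<close> and convex for
  \<open>p \<ge> 2\<close>.  What matters is that for \<open>p > 1\<close> its constant is strictly smaller than the trivial
  \<open>2 powr (p - 1)\<close>: this is the only place where \<open>L\<^sub>p\<close> for \<open>p > 1\<close> is distinguished from \<open>L\<^sub>1\<close>.
\<close>

lemma clarkson_inequality:
  fixes a b :: "'k::real_inner"
  assumes "1 \<le> p"
  shows "norm (a + b) powr p + norm (a - b) powr p
       \<le> 2 * clarkson_const p * (norm a powr p + norm b powr p)"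
proof -
  define q where "q = p / 2"
  have sq: "(u\<^sup>2) powr q = u powr p" if "0 \<le> u" for u :: real
    using that by (cases "u = 0") (simp_all add: q_def powr_powr flip: powr_numeral)
  have par: "(norm (a + b))\<^sup>2 + (norm (a - b))\<^sup>2 = 2 * ((norm a)\<^sup>2 + (norm b)\<^sup>2)"
    by (simp add: power2_norm_eq_inner algebra_simps inner_commute)
  show ?thesis
  proof (cases "p \<le> 2")
    case True
    then have q: "0 < q" "q \<le> 1" using assms by (auto simp: q_def)
    have mean: "s powr q + t powr q \<le> 2 * ((s + t) / 2) powr q" if "0 \<le> s" "0 \<le> t" for s t
    proof -
      have "((s powr q + t powr q) / 2) powr (1 / q) \<le> (s + t) / 2"
        using powr_convex_nonneg[of "1/q" "s powr q" "t powr q" "1/2"] q that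
        by (simp add: powr_powr field_simps)
      then have "(s powr q + t powr q) / 2 \<le> ((s + t) / 2) powr q"
        using q that by (subst (asm) le_powr_inverse_iff) auto
      then show ?thesis by simp
    qed
    have sub: "(s + t) powr q \<le> s powr q + t powr q" if "0 \<le> s" "0 \<le> t" for s t
    proof -
      have "s + t \<le> (s powr q + t powr q) powr (1 / q)"
        using powr_superadditive[of "1/q" "s powr q" "t powr q"] q that
        by (simp add: powr_powr)
      then have "(s + t) powr q \<le> ((s powr q + t powr q) powr (1 / q)) powr q"
        using q that by (intro powr_mono2) auto
      then show ?thesis using q that by (simp add: powr_powr)
    qed
    have "norm (a + b) powr p + norm (a - b) powr p
        = ((norm (a + b))\<^sup>2) powr q + ((norm (a - b))\<^sup>2) powr q"
      by (simp add: sq)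
    also have "\<dots> \<le> 2 * ((norm a)\<^sup>2 + (norm b)\<^sup>2) powr q"
      using mean[of "(norm (a + b))\<^sup>2" "(norm (a - b))\<^sup>2"] unfolding par
      by (simp only: nonzero_mult_div_cancel_left[of 2] zero_le_power2 simp_thms)
    also have "\<dots> \<le> 2 * (norm a powr p + norm b powr p)"
      using sub[of "(norm a)\<^sup>2" "(norm b)\<^sup>2"] by (simp add: sq)
    also have "\<dots> \<le> 2 * clarkson_const p * (norm a powr p + norm b powr p)"
      by (intro mult_right_mono) (auto simp: clarkson_const_def)
    finally show ?thesis .
  next
    case False
    then have q: "1 \<le> q" by (auto simp: q_def)
    have "norm (a + b) powr p + norm (a - b) powr p
        = ((norm (a + b))\<^sup>2) powr q + ((norm (a - b))\<^sup>2) powr q"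
      by (simp add: sq)
    also have "\<dots> \<le> (2 * ((norm a)\<^sup>2 + (norm b)\<^sup>2)) powr q"
      using powr_superadditive[OF q, of "(norm (a + b))\<^sup>2" "(norm (a - b))\<^sup>2"] par by simp
    also have "\<dots> = 2 powr q * ((norm a)\<^sup>2 + (norm b)\<^sup>2) powr q"
      by (rule powr_mult)
    also have "\<dots> \<le> 2 powr q * (2 powr (q - 1) * (norm a powr p + norm b powr p))"
      using powr_sum_two_le[OF q, of "(norm a)\<^sup>2" "(norm b)\<^sup>2"]
      by (intro mult_left_mono) (auto simp: sq)
    also have "\<dots> = 2 * 2 powr (p - 2) * (norm a powr p + norm b powr p)"
    proof -
      have "2 powr q * 2 powr (q - 1) = 2 powr (1 + (p - 2))"
        by (simp add: q_def flip: powr_add)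
      also have "\<dots> = 2 * 2 powr (p - 2)"
        by (subst powr_add) simp
      finally show ?thesis by simp
    qed
    also have "\<dots> \<le> 2 * clarkson_const p * (norm a powr p + norm b powr p)"
      by (intro mult_right_mono) (auto simp: clarkson_const_def)
    finally show ?thesis .
  qed
qed

lemma clarkson_const_strict:
  assumes "1 < p"
  shows "clarkson_const p < 2 powr (p - 1)"
  using assms by (simp add: clarkson_const_def)

section \<open>The seminormed space of \<open>p\<close>-integrable functions\<close>

abbreviation unit_interval :: "real measure" where
  "unit_interval \<equiv> lebesgue_on {0<..<1}"

lemma emeasure_unit_interval: "emeasure unit_interval (space unit_interval) = 1"
proof -
  have "emeasure unit_interval {0<..<1} = emeasure lebesgue {0<..<1::real}"
    by (rule emeasure_restrict_space) auto
  also have "\<dots> = emeasure lborel {0<..<1::real}"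
    by simp
  also have "\<dots> = 1"
    by simp
  finally show ?thesis
    unfolding space_lebesgue_on .
qed

lemma finite_measure_unit_interval: "finite_measure unit_interval"
  by (rule finite_measureI) (simp only: emeasure_unit_interval, simp)

lemma measure_unit_interval: "measure unit_interval (space unit_interval) = 1"
  unfolding measure_def emeasure_unit_interval by simp

lemma Lp_measurable [measurable_dest]: "x \<in> Lp p \<Longrightarrow> x \<in> borel_measurable unit_interval"
  by (simp add: Lp_def)

lemma Lp_integrable: "x \<in> Lp p \<Longrightarrow> integrable unit_interval (\<lambda>t. norm (x t) powr p)"
  by (simp add: Lp_def)

lemma Lp_norm_nonneg: "0 \<le> Lp_norm p x"
  by (simp add: Lp_norm_def)

lemma Lp_norm_powr:
  assumes "1 \<le> p"
  shows "Lp_norm p x powr p = (\<integral>t. norm (x t) powr p \<partial>unit_interval)"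
  using assms by (simp add: Lp_norm_def powr_powr)

lemma Lp_norm_le_iff:
  assumes "1 \<le> p" "0 \<le> B"
  shows "Lp_norm p x \<le> B \<longleftrightarrow> (\<integral>t. norm (x t) powr p \<partial>unit_interval) \<le> B powr p"
  unfolding Lp_norm_def using assms by (subst le_powr_inverse_iff) auto

lemma Lp_norm_cong_AE:
  assumes "AE t in unit_interval. norm (x t) = norm (y t)"
    and "x \<in> borel_measurable unit_interval" "y \<in> borel_measurable unit_interval"
  shows "Lp_norm p x = Lp_norm p y"
proof -
  have "(\<integral>t. norm (x t) powr p \<partial>unit_interval) = (\<integral>t. norm (y t) powr p \<partial>unit_interval)"
    using assms by (intro integral_cong_AE) auto
  then show ?thesis by (simp add: Lp_norm_def)
qed

lemma Lp_dominated:
  assumes "1 \<le> p" "y \<in> Lp p" "x \<in> borel_measurable unit_interval"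
    and "AE t in unit_interval. norm (x t) \<le> norm (y t)"
  shows "x \<in> Lp p" "Lp_norm p x \<le> Lp_norm p y"
proof -
  have le: "AE t in unit_interval. norm (x t) powr p \<le> norm (y t) powr p"
    using assms(4) by eventually_elim (use \<open>1 \<le> p\<close> in \<open>auto intro: powr_mono2\<close>)
  have int: "integrable unit_interval (\<lambda>t. norm (x t) powr p)"
    by (rule Bochner_Integration.integrable_bound[OF Lp_integrable[OF assms(2)]])
       (use assms(3) le in auto)
  then show "x \<in> Lp p" using assms(3) by (simp add: Lp_def)
  have "(\<integral>t. norm (x t) powr p \<partial>unit_interval) \<le> (\<integral>t. norm (y t) powr p \<partial>unit_interval)"
    by (rule integral_mono_AE[OF int Lp_integrable[OF assms(2)] le])
  then show "Lp_norm p x \<le> Lp_norm p y"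
    unfolding Lp_norm_def by (intro powr_mono2) (use \<open>1 \<le> p\<close> in auto)
qed

lemma Lp_zero [simp]: "(\<lambda>t. 0) \<in> Lp p" "Lp_norm p (\<lambda>t. 0) = 0"
  by (auto simp: Lp_def Lp_norm_def)

lemma Lp_cmult:
  assumes "x \<in> Lp p"
  shows "(\<lambda>t. c * x t) \<in> Lp p"
proof -
  have "integrable unit_interval (\<lambda>t. norm c powr p * norm (x t) powr p)"
    using Lp_integrable[OF assms] by simp
  then show ?thesis
    using assms by (auto simp: Lp_def norm_mult powr_mult intro!: borel_measurable_times)
qed

lemma Lp_norm_cmult:
  assumes "1 \<le> p"
  shows "Lp_norm p (\<lambda>t. c * x t) = norm c * Lp_norm p x"
proof -
  have "(\<integral>t. norm (c * x t) powr p \<partial>unit_interval) = norm c powr p * (\<integral>t. norm (x t) powr p \<partial>unit_interval)"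
    by (simp add: norm_mult powr_mult)
  then show ?thesis
    using assms by (simp add: Lp_norm_def powr_mult powr_powr)
qed

lemma Lp_norm_of_real:
  "Lp_norm p (\<lambda>t. of_real (u t) :: 'k::{real_normed_field,euclidean_space}) = Lp_norm p u"
  by (simp add: Lp_norm_def)

lemma Lp_of_real:
  assumes "u \<in> Lp p"
  shows "(\<lambda>t. of_real (u t) :: 'k::{real_normed_field,euclidean_space}) \<in> Lp p"
  using assms by (auto simp: Lp_def intro!: measurable_compose[OF _ borel_measurable_of_real])

lemma Lp_add:
  assumes "1 \<le> p" "x \<in> Lp p" "y \<in> Lp p"
  shows "(\<lambda>t. x t + y t) \<in> Lp p"
proof -
  have "integrable unit_interval (\<lambda>t. norm (x t + y t) powr p)"
  proof (rule Bochner_Integration.integrable_bound)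
    show "integrable unit_interval (\<lambda>t. 2 powr (p - 1) * (norm (x t) powr p + norm (y t) powr p))"
      using assms by (intro integrable_mult_right Bochner_Integration.integrable_add Lp_integrable)
    have "norm (x t + y t) powr p \<le> 2 powr (p - 1) * (norm (x t) powr p + norm (y t) powr p)" for t
      using powr_sum_two_le[OF \<open>1 \<le> p\<close>, of "norm (x t)" "norm (y t)"]
        powr_mono2[of p "norm (x t + y t)" "norm (x t) + norm (y t)"] assms
      by (auto simp: norm_triangle_ineq)
    then show "AE t in unit_interval. norm (norm (x t + y t) powr p)
        \<le> norm (2 powr (p - 1) * (norm (x t) powr p + norm (y t) powr p))"
      by auto
  qed (use assms in measurable)
  then show ?thesis using assms by (auto simp: Lp_def)
qed

text \<open>
  Minkowski's inequality: convexity of the \<open>p\<close>-th power, with weights proportional to the two norms.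
  Working with strict upper bounds \<open>a\<close> and \<open>b\<close> of the norms avoids the case of a vanishing norm.
\<close>

lemma Lp_norm_triangle:
  assumes "1 \<le> p" "x \<in> Lp p" "y \<in> Lp p"
  shows "Lp_norm p (\<lambda>t. x t + y t) \<le> Lp_norm p x + Lp_norm p y"
proof -
  have approx: "Lp_norm p (\<lambda>t. x t + y t) \<le> a + b"
    if "Lp_norm p x \<le> a" "Lp_norm p y \<le> b" "0 < a" "0 < b" for a b
  proof -
    define \<theta> where "\<theta> = b / (a + b)"
    have th: "0 \<le> \<theta>" "\<theta> \<le> 1" "(a + b) * (1 - \<theta>) = a" "(a + b) * \<theta> = b" using that by (auto simp: \<theta>_def field_simps)
    have pw: "norm (x t + y t) powr p \<le> (a + b) powr p *
        ((1 - \<theta>) * (norm (x t) powr p / a powr p) + \<theta> * (norm (y t) powr p / b powr p))" for t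
    proof -
      have "norm (x t + y t) \<le> norm (x t) + norm (y t)"
        by (rule norm_triangle_ineq)
      also have "\<dots> = (a + b) * ((1 - \<theta>) * (norm (x t) / a) + \<theta> * (norm (y t) / b))"
        using that by (simp add: distrib_left th(3,4) flip: mult.assoc)
      finally have "norm (x t + y t) powr p
          \<le> ((a + b) * ((1 - \<theta>) * (norm (x t) / a) + \<theta> * (norm (y t) / b))) powr p"
        using assms by (intro powr_mono2) auto
      also have "\<dots> = (a + b) powr p * ((1 - \<theta>) * (norm (x t) / a) + \<theta> * (norm (y t) / b)) powr p"
        by (simp add: powr_mult)
      also have "\<dots> \<le> (a + b) powr p * ((1 - \<theta>) * (norm (x t) / a) powr p + \<theta> * (norm (y t) / b) powr p)"
        using assms that th by (intro mult_left_mono powr_convex_nonneg) auto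
      finally show ?thesis
        using that by (simp add: powr_divide)
    qed
    have ix: "(\<integral>t. norm (x t) powr p \<partial>unit_interval) / a powr p \<le> 1"
      using Lp_norm_le_iff[of p a x] that assms by (simp add: divide_le_eq)
    have iy: "(\<integral>t. norm (y t) powr p \<partial>unit_interval) / b powr p \<le> 1"
      using Lp_norm_le_iff[of p b y] that assms by (simp add: divide_le_eq)
    have "(\<integral>t. norm (x t + y t) powr p \<partial>unit_interval) \<le> (\<integral>t. (a + b) powr p *
        ((1 - \<theta>) * (norm (x t) powr p / a powr p) + \<theta> * (norm (y t) powr p / b powr p)) \<partial>unit_interval)"
      by (intro integral_mono pw Lp_integrable[OF Lp_add] integrable_mult_right
          Bochner_Integration.integrable_add integrable_divide Lp_integrable assms)
    also have "\<dots> = (a + b) powr p * ((1 - \<theta>) * ((\<integral>t. norm (x t) powr p \<partial>unit_interval) / a powr p)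
        + \<theta> * ((\<integral>t. norm (y t) powr p \<partial>unit_interval) / b powr p))"
      using Lp_integrable[OF assms(2)] Lp_integrable[OF assms(3)] by simp
    also have "\<dots> \<le> (a + b) powr p * ((1 - \<theta>) * 1 + \<theta> * 1)"
      using th ix iy by (intro mult_left_mono add_mono) auto
    finally show ?thesis
      using that assms by (subst Lp_norm_le_iff) auto
  qed
  show ?thesis
  proof (rule field_le_epsilon)
    fix e :: real assume "0 < e"
    then show "Lp_norm p (\<lambda>t. x t + y t) \<le> Lp_norm p x + Lp_norm p y + e"
      using approx[of "Lp_norm p x + e / 2" "Lp_norm p y + e / 2"] Lp_norm_nonneg[of p x]
        Lp_norm_nonneg[of p y] by (simp add: field_simps)
  qed
qed

lemma Lp_sum:
  assumes "1 \<le> p" "finite A" "\<And>i. i \<in> A \<Longrightarrow> x i \<in> Lp p"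
  shows "(\<lambda>t. \<Sum>i\<in>A. x i t) \<in> Lp p"
    and "Lp_norm p (\<lambda>t. \<Sum>i\<in>A. x i t) \<le> (\<Sum>i\<in>A. Lp_norm p (x i))"
proof -
  have "(\<lambda>t. \<Sum>i\<in>A. x i t) \<in> Lp p \<and>
      Lp_norm p (\<lambda>t. \<Sum>i\<in>A. x i t) \<le> (\<Sum>i\<in>A. Lp_norm p (x i))"
    using assms(2,3)
  proof (induction A rule: finite_induct)
    case empty
    then show ?case by simp
  next
    case (insert a A)
    then have "x a \<in> Lp p" "(\<lambda>t. \<Sum>i\<in>A. x i t) \<in> Lp p"
      "Lp_norm p (\<lambda>t. \<Sum>i\<in>A. x i t) \<le> (\<Sum>i\<in>A. Lp_norm p (x i))"
      by auto
    then show ?case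
      using Lp_add[OF \<open>1 \<le> p\<close>] Lp_norm_triangle[OF \<open>1 \<le> p\<close>, of "x a" "\<lambda>t. \<Sum>i\<in>A. x i t"]
        insert.hyps by (simp add: order_trans add_mono)
  qed
  then show "(\<lambda>t. \<Sum>i\<in>A. x i t) \<in> Lp p"
    and "Lp_norm p (\<lambda>t. \<Sum>i\<in>A. x i t) \<le> (\<Sum>i\<in>A. Lp_norm p (x i))" by auto
qed

lemma Lp_diff:
  assumes "1 \<le> p" "x \<in> Lp p" "y \<in> Lp p"
  shows "(\<lambda>t. x t - y t) \<in> Lp p"
  using Lp_add[OF assms(1,2) Lp_cmult[OF assms(3), of "-1"]] by simp

lemma Lp_norm_diff_commute: "Lp_norm p (\<lambda>t. x t - y t) = Lp_norm p (\<lambda>t. y t - x t)"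
  by (simp add: Lp_norm_def norm_minus_commute)

lemma Lp_norm_diff_triangle:
  assumes "1 \<le> p" "x \<in> Lp p" "y \<in> Lp p" "z \<in> Lp p"
  shows "Lp_norm p (\<lambda>t. x t - z t) \<le> Lp_norm p (\<lambda>t. x t - y t) + Lp_norm p (\<lambda>t. y t - z t)"
  using Lp_norm_triangle[OF assms(1) Lp_diff[OF assms(1,2,3)] Lp_diff[OF assms(1,3,4)]] by simp

lemma Lp_norm_le_add_diff:
  assumes "1 \<le> p" "x \<in> Lp p" "y \<in> Lp p"
  shows "Lp_norm p x \<le> Lp_norm p y + Lp_norm p (\<lambda>t. x t - y t)"
  using Lp_norm_triangle[OF assms(1,3) Lp_diff[OF assms(1,2,3)]] by simp

lemma Lp_norm_le_limit:
  assumes "1 \<le> p" "x \<in> Lp p" "\<And>n. y n \<in> Lp p"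
    and "(\<lambda>n. Lp_norm p (\<lambda>t. y n t - x t)) \<longlonglongrightarrow> 0"
    and "\<And>n. Lp_norm p (y n) \<le> B"
  shows "Lp_norm p x \<le> B"
proof (rule LIMSEQ_le_const)
  show "(\<lambda>n. B + Lp_norm p (\<lambda>t. y n t - x t)) \<longlonglongrightarrow> B"
    using tendsto_add[OF tendsto_const assms(4), of B] by simp
  have "Lp_norm p x \<le> B + Lp_norm p (\<lambda>t. y n t - x t)" for n
    using Lp_norm_le_add_diff[OF assms(1,2) assms(3)[of n]] assms(5)[of n]
    by (simp add: Lp_norm_diff_commute[of p x])
  then show "\<exists>N. \<forall>n\<ge>N. Lp_norm p x \<le> B + Lp_norm p (\<lambda>t. y n t - x t)" by auto
qed

text \<open>
  The constant 2 instead of the optimal 1 comes from the crude bound \<open>u \<le> 1 + u powr p\<close>, applied to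
  \<open>u = norm (x t) / c\<close> with \<open>c\<close> slightly larger than the norm of \<open>x\<close>.
\<close>

lemma Lp_imp_integrable:
  assumes "1 \<le> p" "x \<in> Lp p"
  shows "integrable unit_interval x"
    and "(\<integral>t. norm (x t) \<partial>unit_interval) \<le> 2 * Lp_norm p x"
proof -
  interpret finite_measure unit_interval by (rule finite_measure_unit_interval)
  have pw: "norm (x t) \<le> c * (1 + norm (x t) powr p / c powr p)" if "0 < c" for c t
  proof (cases "norm (x t) \<le> c")
    case True
    have "0 \<le> c * (norm (x t) powr p / c powr p)" using that by simp
    then show ?thesis using True by (simp add: algebra_simps)
  next
    case False
    then have "1 \<le> norm (x t) / c" using that by simp
    then have "(norm (x t) / c) powr 1 \<le> (norm (x t) / c) powr p"
      using assms(1) by (intro powr_mono) auto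
    then have "norm (x t) / c \<le> norm (x t) powr p / c powr p"
      using that by (simp add: powr_divide)
    then have "norm (x t) \<le> c * (norm (x t) powr p / c powr p)"
      using that by (simp add: pos_divide_le_eq mult.commute)
    then show ?thesis using that by (simp only: distrib_left mult_1_right)
  qed
  have bnd: "integrable unit_interval (\<lambda>t. c * (1 + norm (x t) powr p / c powr p))" for c
    using Lp_integrable[OF assms(2)]
    by (intro integrable_mult_right Bochner_Integration.integrable_add integrable_divide) auto
  show int: "integrable unit_interval x"
    by (rule Bochner_Integration.integrable_bound[OF bnd[of 1]])
       (use assms pw[of 1] in \<open>auto simp: Lp_def\<close>)
  have le: "(\<integral>t. norm (x t) \<partial>unit_interval) \<le> 2 * c" if "Lp_norm p x \<le> c" "0 < c" for c
  proof -
    have "(\<integral>t. norm (x t) \<partial>unit_interval)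
        \<le> (\<integral>t. c * (1 + norm (x t) powr p / c powr p) \<partial>unit_interval)"
      using int by (intro integral_mono bnd pw that) auto
    also have "\<dots> = c * (1 + (\<integral>t. norm (x t) powr p \<partial>unit_interval) / c powr p)"
      using Lp_integrable[OF assms(2)] measure_unit_interval by simp
    also have "\<dots> \<le> c * (1 + 1)"
      using Lp_norm_le_iff[of p c x] that assms by (intro mult_left_mono add_mono) (auto simp: divide_le_eq)
    finally show ?thesis by simp
  qed
  show "(\<integral>t. norm (x t) \<partial>unit_interval) \<le> 2 * Lp_norm p x"
  proof (rule field_le_epsilon)
    fix e :: real assume "0 < e"
    then show "(\<integral>t. norm (x t) \<partial>unit_interval) \<le> 2 * Lp_norm p x + e"
      using le[of "Lp_norm p x + e / 2"] Lp_norm_nonneg[of p x] by simp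
  qed
qed

section \<open>Completeness\<close>

text \<open>
  The Riesz--Fischer argument: by Minkowski's inequality and monotone convergence the series of
  absolute values has a finite sum almost everywhere, and its \<open>p\<close>-th power is an integrable
  majorant for dominated convergence.
\<close>

lemma Lp_complete:
  fixes x :: "nat \<Rightarrow> real \<Rightarrow> 'k::{real_normed_field,euclidean_space}"
  assumes p: "1 \<le> p" and x: "\<And>k. x k \<in> Lp p" and sm: "summable (\<lambda>k. Lp_norm p (x k))"
  shows "\<exists>y\<in>Lp p. (\<lambda>n. Lp_norm p (\<lambda>t. (\<Sum>k<n. x k t) - y t)) \<longlonglongrightarrow> 0"
proof -
  have [measurable]: "x k \<in> borel_measurable unit_interval" for k
    using x by (auto simp: Lp_def)
  define S where "S = (\<Sum>k. Lp_norm p (x k))"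
  define h where "h n t = (\<Sum>k<n. norm (x k t))" for n t
  define F where "F t = (SUP n. ennreal (h n t powr p))" for t
  define G where "G t = enn2real (F t)" for t
  define y where "y t = (\<Sum>k. x k t)" for t
  have h_nonneg: "0 \<le> h n t" for n t by (simp add: h_def sum_nonneg)
  have h_mono: "h m t \<le> h n t" if "m \<le> n" for m n t
    unfolding h_def using that by (intro sum_mono2) auto
  have [measurable]: "h n \<in> borel_measurable unit_interval" for n
    unfolding h_def by measurable
  have [measurable]: "F \<in> borel_measurable unit_interval" "G \<in> borel_measurable unit_interval"
    unfolding F_def G_def by measurable
  have [measurable]: "y \<in> borel_measurable unit_interval"
    unfolding y_def by measurable
  have norm_Lp: "(\<lambda>t. norm (x k t)) \<in> Lp p" for k
    using x[of k] by (simp add: Lp_def)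
  have hLp: "h n \<in> Lp p" "Lp_norm p (h n) \<le> S" for n
  proof -
    show "h n \<in> Lp p"
      unfolding h_def by (rule Lp_sum(1)[OF p]) (auto simp: norm_Lp)
    have "Lp_norm p (h n) \<le> (\<Sum>k<n. Lp_norm p (\<lambda>t. norm (x k t)))"
      unfolding h_def by (rule Lp_sum(2)[OF p]) (auto simp: norm_Lp)
    also have "\<dots> = (\<Sum>k<n. Lp_norm p (x k))"
      by (simp add: Lp_norm_def)
    also have "\<dots> \<le> S"
      unfolding S_def by (rule sum_le_suminf[OF sm]) (auto simp: Lp_norm_nonneg)
    finally show "Lp_norm p (h n) \<le> S" .
  qed
  have S0: "0 \<le> S" using hLp(2)[of 0] Lp_norm_nonneg[of p "h 0"] by linarith
  have "(\<integral>\<^sup>+t. F t \<partial>unit_interval) = (SUP n. \<integral>\<^sup>+t. ennreal (h n t powr p) \<partial>unit_interval)"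
    unfolding F_def
  proof (rule nn_integral_monotone_convergence_SUP)
    show "incseq (\<lambda>n t. ennreal (h n t powr p))"
      by (intro incseq_SucI le_funI ennreal_leI powr_mono2) (use p h_nonneg h_mono in auto)
  qed simp
  also have "\<dots> \<le> ennreal (S powr p)"
  proof (rule SUP_least)
    fix n
    have "(\<integral>\<^sup>+t. ennreal (h n t powr p) \<partial>unit_interval) = ennreal (\<integral>t. h n t powr p \<partial>unit_interval)"
      using Lp_integrable[OF hLp(1)[of n]] h_nonneg[of n]
      by (intro nn_integral_eq_integral) auto
    also have "\<dots> \<le> ennreal (S powr p)"
      using Lp_norm_le_iff[OF p S0, of "h n"] hLp(2)[of n] h_nonneg[of n] by (intro ennreal_leI) auto
    finally show "(\<integral>\<^sup>+t. ennreal (h n t powr p) \<partial>unit_interval) \<le> ennreal (S powr p)" .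
  qed
  finally have Fint: "(\<integral>\<^sup>+t. F t \<partial>unit_interval) \<le> ennreal (S powr p)" .
  then have Ffin: "AE t in unit_interval. F t \<noteq> \<infinity>"
    by (intro nn_integral_PInf_AE) (auto simp: top_unique)
  have Gint: "integrable unit_interval G"
  proof (rule integrableI_bounded)
    have "(\<integral>\<^sup>+t. ennreal (norm (G t)) \<partial>unit_interval) \<le> (\<integral>\<^sup>+t. F t \<partial>unit_interval)"
      by (intro nn_integral_mono) (simp add: G_def ennreal_enn2real_if)
    also have "\<dots> < \<infinity>"
      using Fint by (simp add: le_less_trans)
    finally show "(\<integral>\<^sup>+t. ennreal (norm (G t)) \<partial>unit_interval) < \<infinity>" .
  qed simp
  have good: "(\<lambda>n. \<Sum>k<n. x k t) \<longlonglongrightarrow> y t \<and> (\<forall>n. norm ((\<Sum>k<n. x k t) - y t) powr p \<le> G t)"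
    if "F t \<noteq> \<infinity>" for t
  proof -
    have hG: "h n t powr p \<le> G t" for n
    proof -
      have "ennreal (h n t powr p) \<le> F t" unfolding F_def by (rule SUP_upper) simp
      also have "F t = ennreal (G t)" using that by (simp add: G_def less_top)
      finally show ?thesis by (simp add: G_def)
    qed
    have hb: "h n t \<le> G t powr (1 / p)" for n
    proof -
      have "(h n t powr p) powr (1 / p) \<le> G t powr (1 / p)"
        using hG[of n] p by (intro powr_mono2) auto
      then show ?thesis using h_nonneg p by (simp add: powr_powr)
    qed
    have sn: "summable (\<lambda>k. norm (x k t))"
      by (rule summableI_nonneg_bounded[of _ "G t powr (1 / p)"]) (use hb in \<open>auto simp: h_def\<close>)
    then have lim: "(\<lambda>n. \<Sum>k<n. x k t) \<longlonglongrightarrow> y t"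
      unfolding y_def by (rule summable_LIMSEQ[OF summable_norm_cancel])
    have "norm ((\<Sum>k<n. x k t) - y t) \<le> G t powr (1 / p)" for n
    proof (rule LIMSEQ_le_const2)
      show "(\<lambda>m. norm ((\<Sum>k<n. x k t) - (\<Sum>k<m. x k t))) \<longlonglongrightarrow> norm ((\<Sum>k<n. x k t) - y t)"
        by (intro tendsto_intros lim)
      have "norm ((\<Sum>k<n. x k t) - (\<Sum>k<m. x k t)) \<le> G t powr (1 / p)" if "n \<le> m" for m
      proof -
        have "(\<Sum>k<m. x k t) = (\<Sum>k<n. x k t) + (\<Sum>k=n..<m. x k t)"
          using that by (simp add: lessThan_atLeast0 sum.atLeastLessThan_concat)
        then have "norm ((\<Sum>k<n. x k t) - (\<Sum>k<m. x k t)) \<le> (\<Sum>k=n..<m. norm (x k t))"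
          by (simp add: norm_sum)
        also have "\<dots> \<le> h m t"
          unfolding h_def by (intro sum_mono2) auto
        finally show ?thesis using hb[of m] by simp
      qed
      then show "\<exists>N. \<forall>m\<ge>N. norm ((\<Sum>k<n. x k t) - (\<Sum>k<m. x k t)) \<le> G t powr (1 / p)" by blast
    qed
    then have "norm ((\<Sum>k<n. x k t) - y t) powr p \<le> (G t powr (1 / p)) powr p" for n
      using p by (intro powr_mono2) auto
    moreover have "0 \<le> G t" by (simp add: G_def)
    ultimately show ?thesis using lim p by (simp add: powr_powr)
  qed
  have yLp: "y \<in> Lp p"
  proof -
    have "integrable unit_interval (\<lambda>t. norm (y t) powr p)"
    proof (rule Bochner_Integration.integrable_bound[OF Gint])
      show "AE t in unit_interval. norm (norm (y t) powr p) \<le> norm (G t)"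
        using Ffin
      proof eventually_elim
        case (elim t)
        then have "norm ((\<Sum>k<0. x k t) - y t) powr p \<le> G t" using good by blast
        then show ?case by simp
      qed
    qed simp
    then show ?thesis by (simp add: Lp_def)
  qed
  have "(\<lambda>n. \<integral>t. norm ((\<Sum>k<n. x k t) - y t) powr p \<partial>unit_interval) \<longlonglongrightarrow> (\<integral>t. 0 \<partial>unit_interval)"
  proof (rule integral_dominated_convergence[OF _ _ Gint])
    show "AE t in unit_interval. (\<lambda>n. norm ((\<Sum>k<n. x k t) - y t) powr p) \<longlonglongrightarrow> 0"
      using Ffin
    proof eventually_elim
      case (elim t)
      have "(\<lambda>n. norm ((\<Sum>k<n. x k t) - y t)) \<longlonglongrightarrow> 0"
        using good[OF elim] by (simp add: tendsto_norm_zero LIM_zero)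
      then show ?case
        by (rule tendsto_zero_powrI[OF _ tendsto_const]) (use p in auto)
    qed
    show "AE t in unit_interval. norm (norm ((\<Sum>k<n. x k t) - y t) powr p) \<le> G t" for n
      using Ffin by eventually_elim (use good in auto)
  qed simp_all
  then have "(\<lambda>n. Lp_norm p (\<lambda>t. (\<Sum>k<n. x k t) - y t)) \<longlonglongrightarrow> 0"
    unfolding Lp_norm_def by (intro tendsto_zero_powrI[OF _ tendsto_const]) (use p in auto)
  with yLp show ?thesis by blast
qed

lemma Lp_geometric_Cauchy_limit:
  fixes x :: "nat \<Rightarrow> real \<Rightarrow> 'k::{real_normed_field,euclidean_space}"
  assumes p: "1 \<le> p" and x: "\<And>n. x n \<in> Lp p"
    and step: "\<And>n. Lp_norm p (\<lambda>t. x (Suc n) t - x n t) \<le> \<rho> n"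
    and half: "\<And>n. 2 * \<rho> (Suc n) \<le> \<rho> n"
  shows "\<exists>y\<in>Lp p. \<forall>n. Lp_norm p (\<lambda>t. y t - x n t) \<le> 2 * \<rho> n"
proof -
  have \<rho>0: "0 \<le> \<rho> n" for n
    using step[of n] Lp_norm_nonneg order_trans by blast
  have \<rho>_geo: "\<rho> n \<le> \<rho> 0 * (1/2) ^ n" for n
  proof (induction n)
    case (Suc n)
    then show ?case using half[of n] by simp
  qed simp
  have d: "(\<lambda>t. x (Suc k) t - x k t) \<in> Lp p" for k
    by (intro Lp_diff p x)
  have sm: "summable (\<lambda>k. Lp_norm p (\<lambda>t. x (Suc k) t - x k t))"
  proof (rule summable_comparison_test')
    show "summable (\<lambda>k. \<rho> 0 * (1/2) ^ k)" by (intro summable_mult summable_geometric) simp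
    show "norm (Lp_norm p (\<lambda>t. x (Suc k) t - x k t)) \<le> \<rho> 0 * (1/2) ^ k" for k
      using step[of k] \<rho>_geo[of k] by (simp add: Lp_norm_nonneg)
  qed
  then obtain z where z: "z \<in> Lp p"
    "(\<lambda>n. Lp_norm p (\<lambda>t. (\<Sum>k<n. x (Suc k) t - x k t) - z t)) \<longlonglongrightarrow> 0"
    using Lp_complete[OF p d sm] by blast
  define y where "y t = z t + x 0 t" for t
  have yLp: "y \<in> Lp p" unfolding y_def by (rule Lp_add[OF p z(1) x])
  have tel: "(\<Sum>k<n. x (Suc k) t - x k t) = x n t - x 0 t" for n t
    by (rule sum_lessThan_telescope)
  have lim: "(\<lambda>n. Lp_norm p (\<lambda>t. x n t - y t)) \<longlonglongrightarrow> 0"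
    using z(2) unfolding tel y_def by (simp add: algebra_simps)
  have tail: "Lp_norm p (\<lambda>t. x m t - x n t) \<le> 2 * \<rho> n - 2 * \<rho> m" if "n \<le> m" for m n
    using that
  proof (induction m rule: dec_induct)
    case base
    then show ?case by simp
  next
    case (step m)
    have "Lp_norm p (\<lambda>t. x (Suc m) t - x n t)
        \<le> Lp_norm p (\<lambda>t. x (Suc m) t - x m t) + Lp_norm p (\<lambda>t. x m t - x n t)"
      by (rule Lp_norm_diff_triangle[OF p x x x])
    also have "\<dots> \<le> \<rho> m + (2 * \<rho> n - 2 * \<rho> m)"
      by (intro add_mono step.IH assms(3))
    finally show ?case using half[of m] by simp
  qed
  have "Lp_norm p (\<lambda>t. y t - x n t) \<le> 2 * \<rho> n" for n
  proof (rule LIMSEQ_le_const)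
    show "(\<lambda>m. Lp_norm p (\<lambda>t. x m t - y t) + 2 * \<rho> n) \<longlonglongrightarrow> 2 * \<rho> n"
      using tendsto_add[OF lim tendsto_const, of "2 * \<rho> n"] by simp
    have "Lp_norm p (\<lambda>t. y t - x n t) \<le> Lp_norm p (\<lambda>t. x m t - y t) + 2 * \<rho> n" if "n \<le> m" for m
      using Lp_norm_diff_triangle[OF p yLp x[of m] x[of n]] tail[OF that] \<rho>0[of m]
      by (simp add: Lp_norm_diff_commute[of p y])
    then show "\<exists>N. \<forall>m\<ge>N. Lp_norm p (\<lambda>t. y t - x n t) \<le> Lp_norm p (\<lambda>t. x m t - y t) + 2 * \<rho> n"
      by blast
  qed
  with yLp show ?thesis by blast
qed

section \<open>Uniform boundedness\<close>

text \<open>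
  The uniform boundedness principle for a family of continuous seminorms on a closed subspace of
  \<open>L\<^sub>p\<close>, by a gliding hump.  If no uniform bound exists, there are steps \<open>z\<close> of any prescribed
  norm \<open>\<rho>\<close> and seminorms \<open>q i\<close> such that \<open>q i z\<close> is as large as desired; since
  \<open>2 * q i z \<le> q i (x + z) + q i (x - z)\<close>, one of the two moves away from the current point \<open>x\<close>
  reaches a point where \<open>q i\<close> is large.  Later steps are chosen so small that \<open>q i\<close> stays large on
  the whole ball that they can reach, so the limit has unbounded seminorms.
\<close>

lemma Lp_uniform_boundedness:
  fixes X :: "(real \<Rightarrow> 'k::{real_normed_field,euclidean_space}) set"
    and q :: "'i \<Rightarrow> (real \<Rightarrow> 'k) \<Rightarrow> real"
  assumes p: "1 \<le> p" and XLp: "X \<subseteq> Lp p" and X0: "(\<lambda>t. 0) \<in> X"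
    and Xadd: "\<And>x y. x \<in> X \<Longrightarrow> y \<in> X \<Longrightarrow> (\<lambda>t. x t + y t) \<in> X"
    and Xscale: "\<And>c x. x \<in> X \<Longrightarrow> (\<lambda>t. c * x t) \<in> X"
    and Xclosed: "\<And>x. x \<in> Lp p \<Longrightarrow> (\<And>e. 0 < e \<Longrightarrow> \<exists>y\<in>X. Lp_norm p (\<lambda>t. x t - y t) < e) \<Longrightarrow> x \<in> X"
    and qadd: "\<And>i x y. i \<in> I \<Longrightarrow> x \<in> X \<Longrightarrow> y \<in> X \<Longrightarrow> q i (\<lambda>t. x t + y t) \<le> q i x + q i y"
    and qscale: "\<And>i c x. i \<in> I \<Longrightarrow> x \<in> X \<Longrightarrow> q i (\<lambda>t. c * x t) = norm c * q i x"
    and qcont: "\<And>i. i \<in> I \<Longrightarrow> \<exists>C. \<forall>x\<in>X. q i x \<le> C * Lp_norm p x"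
    and pointwise: "\<And>x. x \<in> X \<Longrightarrow> \<exists>B. \<forall>i\<in>I. q i x \<le> B"
  shows "\<exists>K\<ge>0. \<forall>i\<in>I. \<forall>x\<in>X. q i x \<le> K * Lp_norm p x"
proof (rule ccontr)
  assume no: "\<not> ?thesis"
  have Xdiff: "(\<lambda>t. x t - y t) \<in> X" if "x \<in> X" "y \<in> X" for x y
    using Xadd[OF that(1) Xscale[OF that(2), of "-1"]] by simp
  have qdiff_commute: "q i (\<lambda>t. x t - y t) = q i (\<lambda>t. y t - x t)" if "i \<in> I" "x \<in> X" "y \<in> X" for i x y
    using qscale[OF that(1) Xdiff[OF that(2,3)], of "-1"] by simp
  define P where "P = (\<lambda>(n::nat) (s :: (real \<Rightarrow> 'k) \<times> real). fst s \<in> X \<and> 0 < snd s)"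
  \<comment> \<open>A state is a point together with the length allowed for the next step.  The balls of radius
     twice that length are nested, and on the ball after step \<open>n\<close> some seminorm is at least \<open>n\<close>.\<close>
  define Q where "Q = (\<lambda>(n::nat) (s :: (real \<Rightarrow> 'k) \<times> real) s'.
     Lp_norm p (\<lambda>t. fst s' t - fst s t) \<le> snd s \<and> 2 * snd s' \<le> snd s \<and>
     (\<exists>i\<in>I. \<forall>w\<in>X. Lp_norm p (\<lambda>t. w t - fst s' t) \<le> 2 * snd s' \<longrightarrow> real n \<le> q i w))"
  have step: "\<exists>s'. P (Suc n) s' \<and> Q n s s'" if "P n s" for n s
  proof -
    obtain x \<rho> where s: "s = (x, \<rho>)" by (cases s)
    then have x: "x \<in> X" and \<rho>: "0 < \<rho>" using that by (auto simp: P_def)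
    define K where "K = (real n + 1) / \<rho>"
    have "0 \<le> K" using \<rho> by (simp add: K_def)
    then obtain i z0 where i: "i \<in> I" and z0: "z0 \<in> X" "K * Lp_norm p z0 < q i z0"
      using no by force
    obtain C0 where C0: "\<forall>x\<in>X. q i x \<le> C0 * Lp_norm p x" using qcont[OF i] by blast
    define C where "C = \<bar>C0\<bar> + 1"
    have C: "0 < C" "q i x \<le> C * Lp_norm p x" if "x \<in> X" for x
      using C0 that Lp_norm_nonneg[of p x] mult_right_mono[of C0 C "Lp_norm p x"]
      unfolding C_def by force+
    have n0: "0 < Lp_norm p z0"
    proof (rule ccontr)
      assume "\<not> 0 < Lp_norm p z0"
      then have "Lp_norm p z0 = 0" using Lp_norm_nonneg[of p z0] by simp
      then show False using z0 C(2)[OF z0(1)] by simp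
    qed
    define z where "z t = of_real (\<rho> / Lp_norm p z0) * z0 t" for t
    have z: "z \<in> X" unfolding z_def by (rule Xscale[OF z0(1)])
    have nz: "Lp_norm p z = \<rho>"
      unfolding z_def using n0 \<rho> by (subst Lp_norm_cmult[OF p]) (simp add: norm_divide)
    have qz_eq: "q i z = \<rho> / Lp_norm p z0 * q i z0"
      unfolding z_def using n0 \<rho> by (subst qscale[OF i z0(1)]) (simp add: norm_divide)
    have "(real n + 1) * Lp_norm p z0 < \<rho> * q i z0"
      using z0(2) \<rho> by (simp add: K_def field_simps)
    also have "\<dots> = q i z * Lp_norm p z0"
      unfolding qz_eq using n0 by simp
    finally have qz: "real n + 1 \<le> q i z"
      using n0 by (simp add: mult_less_cancel_right)
    have "(\<lambda>t. 2 * z t) = (\<lambda>t. (x t + z t) + (z t - x t))"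
      by (rule ext, algebra)
    then have "q i (\<lambda>t. 2 * z t) \<le> q i (\<lambda>t. x t + z t) + q i (\<lambda>t. z t - x t)"
      by (metis qadd[OF i Xadd[OF x z] Xdiff[OF z x]])
    then have "2 * q i z \<le> q i (\<lambda>t. x t + z t) + q i (\<lambda>t. x t - z t)"
      using qscale[OF i z, of 2] qdiff_commute[OF i z x] by simp
    then have or: "real n + 1 \<le> q i (\<lambda>t. x t + z t) \<or> real n + 1 \<le> q i (\<lambda>t. x t - z t)"
      using qz by linarith
    obtain x' where x': "x' \<in> X" "real n + 1 \<le> q i x'" "Lp_norm p (\<lambda>t. x' t - x t) \<le> \<rho>"
    proof (cases "real n + 1 \<le> q i (\<lambda>t. x t + z t)")
      case True
      show ?thesis by (rule that[OF Xadd[OF x z] True]) (simp add: nz)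
    next
      case False
      show ?thesis
        by (rule that[OF Xdiff[OF x z]]) (use False or nz Lp_norm_cmult[OF p, of "-1" z] in auto)
    qed
    \<comment> \<open>Within distance \<open>2 * \<rho>'\<close>, the seminorm \<open>q i\<close> changes by at most 1.\<close>
    define \<rho>' where "\<rho>' = min (\<rho> / 2) (1 / (2 * C))"
    have \<rho>': "0 < \<rho>'" "2 * \<rho>' \<le> \<rho>" "2 * \<rho>' * C \<le> 1"
    proof -
      have "0 < C" using C(1) X0 by blast
      then show "0 < \<rho>'" "2 * \<rho>' \<le> \<rho>" using \<rho> by (auto simp: \<rho>'_def)
      have "2 * \<rho>' * C \<le> 2 * (1 / (2 * C)) * C"
        using \<open>0 < C\<close> by (intro mult_right_mono mult_left_mono) (auto simp: \<rho>'_def)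
      then show "2 * \<rho>' * C \<le> 1" using \<open>0 < C\<close> by simp
    qed
    have "real n \<le> q i w" if w: "w \<in> X" "Lp_norm p (\<lambda>t. w t - x' t) \<le> 2 * \<rho>'" for w
    proof -
      have "q i x' \<le> q i w + q i (\<lambda>t. x' t - w t)"
        using qadd[OF i w(1) Xdiff[OF x'(1) w(1)]] by simp
      moreover have "q i (\<lambda>t. x' t - w t) \<le> C * Lp_norm p (\<lambda>t. x' t - w t)"
        by (rule C(2)[OF Xdiff[OF x'(1) w(1)]])
      moreover have "C * Lp_norm p (\<lambda>t. x' t - w t) \<le> C * (2 * \<rho>')"
        using w(2) C(1)[OF X0] by (intro mult_left_mono) (auto simp: Lp_norm_diff_commute[of p x'])
      ultimately show ?thesis using x'(2) \<rho>'(3) by (simp add: mult.commute)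
    qed
    then have "P (Suc n) (x', \<rho>') \<and> Q n s (x', \<rho>')"
      using x' \<rho>' i s by (auto simp: P_def Q_def)
    then show ?thesis by blast
  qed
  have "\<exists>f. \<forall>n. P n (f n) \<and> Q n (f n) (f (Suc n))"
  proof (rule dependent_nat_choice)
    show "\<exists>s. P 0 s"
      by (rule exI[of _ "(\<lambda>t. 0, 1)"]) (simp add: P_def X0)
  qed (rule step)
  then obtain s where s: "\<And>n. P n (s n)" "\<And>n. Q n (s n) (s (Suc n))" by blast
  define x where "x n = fst (s n)" for n
  define \<rho> where "\<rho> n = snd (s n)" for n
  have xX: "x n \<in> X" for n using s(1)[of n] by (simp add: P_def x_def)
  have "\<exists>y\<in>Lp p. \<forall>n. Lp_norm p (\<lambda>t. y t - x n t) \<le> 2 * \<rho> n"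
    by (rule Lp_geometric_Cauchy_limit[OF p])
       (use s(2) xX XLp in \<open>auto simp: Q_def x_def \<rho>_def\<close>)
  then obtain y where y: "y \<in> Lp p" "\<And>n. Lp_norm p (\<lambda>t. y t - x n t) \<le> 2 * \<rho> n" by blast
  have \<rho>_geo: "\<rho> n \<le> \<rho> 0 * (1/2) ^ n" for n
  proof (induction n)
    case (Suc n)
    then show ?case using s(2)[of n] by (simp add: Q_def \<rho>_def)
  qed simp
  have yX: "y \<in> X"
  proof (rule Xclosed[OF y(1)])
    fix e :: real assume "0 < e"
    have "(\<lambda>n. 2 * (\<rho> 0 * (1/2) ^ n)) \<longlonglongrightarrow> 2 * (\<rho> 0 * 0)"
      by (intro tendsto_intros LIMSEQ_power_zero) simp
    then have "eventually (\<lambda>n. 2 * (\<rho> 0 * (1/2) ^ n) < e) sequentially"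
      using \<open>0 < e\<close> by (intro order_tendstoD(2)) auto
    then obtain n where "2 * (\<rho> 0 * (1/2) ^ n) < e" using eventually_happens by force
    then have "Lp_norm p (\<lambda>t. y t - x n t) < e" using y(2)[of n] \<rho>_geo[of n] by linarith
    then show "\<exists>z\<in>X. Lp_norm p (\<lambda>t. y t - z t) < e" using xX by blast
  qed
  obtain B where B: "\<forall>i\<in>I. q i y \<le> B" using pointwise[OF yX] by blast
  obtain n :: nat where n: "B < real n" using reals_Archimedean2 by blast
  obtain i where "i \<in> I" "real n \<le> q i y"
    using s(2)[of n] yX y(2)[of "Suc n"] by (auto simp: Q_def x_def \<rho>_def)
  then show False using B n by force
qed

section \<open>Truncation and approximation by simple functions\<close>

text \<open>
  Non-negative functions with small integral are almost disjoint from a fixed \<open>G\<close> in \<open>L\<^sub>p\<close>,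
  uniformly and regardless of the size of their \<open>L\<^sub>p\<close> norm.  Where \<open>G \<le> m\<close>, the \<open>p\<close>-th power of
  the minimum is at most \<open>m powr (p - 1) * y\<close>; on the rest it is at most \<open>G powr p\<close>, whose
  integral over \<open>{G > m}\<close> is small for large \<open>m\<close>.
\<close>

lemma Lp_norm_min_small:
  fixes G :: "real \<Rightarrow> real"
  assumes p: "1 \<le> p" and G: "G \<in> Lp p" "\<And>t. 0 \<le> G t" and \<eta>: "0 < \<eta>"
  shows "\<exists>\<epsilon>>0. \<forall>y\<in>Lp p. (\<forall>t. 0 \<le> y t) \<longrightarrow> (\<integral>t. y t \<partial>unit_interval) \<le> \<epsilon>
           \<longrightarrow> Lp_norm p (\<lambda>t. min (G t) (y t)) \<le> \<eta>"
proof -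
  have [measurable]: "G \<in> borel_measurable unit_interval" using G(1) by (simp add: Lp_def)
  have Gint: "integrable unit_interval (\<lambda>t. G t powr p)"
    using Lp_integrable[OF G(1)] G(2) by simp
  define H where "H m t = (if real m < G t then G t powr p else 0)" for m t
  have [measurable]: "H m \<in> borel_measurable unit_interval" for m
    unfolding H_def[abs_def] by measurable
  have "(\<lambda>m. \<integral>t. H m t \<partial>unit_interval) \<longlonglongrightarrow> (\<integral>t. 0 \<partial>unit_interval)"
  proof (rule integral_dominated_convergence[OF _ _ Gint])
    show "AE t in unit_interval. (\<lambda>m. H m t) \<longlonglongrightarrow> 0"
    proof (rule AE_I2)
      fix t
      obtain m0 :: nat where "G t < real m0" using reals_Archimedean2 by blast
      then have "eventually (\<lambda>m. H m t = 0) sequentially"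
        by (intro eventually_sequentiallyI[of m0]) (auto simp: H_def)
      then show "(\<lambda>m. H m t) \<longlonglongrightarrow> 0" by (rule tendsto_eventually)
    qed
  qed (auto simp: H_def)
  then have "eventually (\<lambda>m. (\<integral>t. H m t \<partial>unit_interval) < \<eta> powr p / 2) sequentially"
    using \<eta> by (intro order_tendstoD(2)) auto
  then obtain m0 where m0: "(\<integral>t. H m t \<partial>unit_interval) < \<eta> powr p / 2" if "m0 \<le> m" for m
    by (auto simp: eventually_sequentially)
  define m where "m = Suc m0"
  define \<epsilon> where "\<epsilon> = \<eta> powr p / (2 * real m powr (p - 1))"
  have Hint: "integrable unit_interval (H m)"
    by (rule Bochner_Integration.integrable_bound[OF Gint]) (auto simp: H_def)
  have "Lp_norm p (\<lambda>t. min (G t) (y t)) \<le> \<eta>"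
    if y: "y \<in> Lp p" "\<forall>t. 0 \<le> y t" "(\<integral>t. y t \<partial>unit_interval) \<le> \<epsilon>" for y
  proof -
    have [measurable]: "y \<in> borel_measurable unit_interval" using y(1) by (simp add: Lp_def)
    have pw: "norm (min (G t) (y t)) powr p \<le> H m t + real m powr (p - 1) * y t" for t
    proof (cases "real m < G t")
      case True
      have "min (G t) (y t) powr p \<le> G t powr p"
        using p G(2)[of t] y(2) by (intro powr_mono2) auto
      then show ?thesis using True G(2)[of t] y(2) by (simp add: H_def add_increasing2)
    next
      case False
      define u where "u = min (G t) (y t)"
      have u: "0 \<le> u" "u \<le> real m" "u \<le> y t" using False G(2)[of t] y(2) by (auto simp: u_def)
      have "u powr p = u powr (p - 1) * u"
        using powr_add[of u "p - 1" 1] u by simp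
      also have "\<dots> \<le> real m powr (p - 1) * y t"
        using u p by (intro mult_mono powr_mono2) auto
      finally show ?thesis using False u(1) by (simp add: H_def u_def)
    qed
    have minLp: "(\<lambda>t. min (G t) (y t)) \<in> Lp p"
      by (rule Lp_dominated(1)[OF p G(1)]) (use G(2) y(2) in \<open>auto intro!: AE_I2 simp: min_def\<close>)
    have yint: "integrable unit_interval y" by (rule Lp_imp_integrable(1)[OF p y(1)])
    have "(\<integral>t. norm (min (G t) (y t)) powr p \<partial>unit_interval)
        \<le> (\<integral>t. H m t + real m powr (p - 1) * y t \<partial>unit_interval)"
      by (intro integral_mono Lp_integrable[OF minLp] pw Bochner_Integration.integrable_add Hint
          integrable_mult_right yint)
    also have "\<dots> = (\<integral>t. H m t \<partial>unit_interval) + real m powr (p - 1) * (\<integral>t. y t \<partial>unit_interval)"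
      using Hint yint by simp
    also have "\<dots> \<le> \<eta> powr p / 2 + real m powr (p - 1) * \<epsilon>"
      using m0[of m] y(3) by (intro add_mono mult_left_mono) (auto simp: m_def)
    also have "\<dots> = \<eta> powr p"
      by (simp add: \<epsilon>_def m_def)
    finally show ?thesis using \<eta> by (simp add: Lp_norm_le_iff[OF p])
  qed
  moreover have "0 < \<epsilon>" using \<eta> by (simp add: \<epsilon>_def m_def)
  ultimately show ?thesis by blast
qed

lemma Lp_simple_approximation_below:
  fixes r :: "real \<Rightarrow> real"
  assumes p: "1 \<le> p" and r: "r \<in> Lp p" "\<And>t. 0 \<le> r t" and \<delta>: "0 < \<delta>"
  shows "\<exists>s. simple_function unit_interval s \<and> (\<forall>t. 0 \<le> s t \<and> s t \<le> r t)
           \<and> Lp_norm p (\<lambda>t. r t - s t) \<le> \<delta>"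
proof -
  have [measurable]: "r \<in> borel_measurable unit_interval" using r(1) by (simp add: Lp_def)
  obtain U where U: "incseq U" "\<And>i. simple_function unit_interval (U i)"
    "\<And>t. bdd_above (range (\<lambda>i. U i t))" "\<And>i t. 0 \<le> U i t" "r = (SUP i. U i)"
    using borel_measurable_implies_simple_function_sequence_real[of r unit_interval] r(2) by auto
  have [measurable]: "U i \<in> borel_measurable unit_interval" for i
    by (rule borel_measurable_simple_function[OF U(2)])
  have rSup: "r t = (SUP i. U i t)" for t using U(5) by (simp add: SUP_apply image_comp)
  have le: "U i t \<le> r t" for i t
    unfolding rSup by (rule cSUP_upper[OF _ U(3)]) simp
  have lim: "(\<lambda>i. U i t) \<longlonglongrightarrow> r t" for t
    unfolding rSup using U(1,3) by (intro LIMSEQ_incseq_SUP) (auto simp: incseq_def le_fun_def)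
  have "(\<lambda>i. \<integral>t. norm (r t - U i t) powr p \<partial>unit_interval) \<longlonglongrightarrow> (\<integral>t. 0 \<partial>unit_interval)"
  proof (rule integral_dominated_convergence[OF _ _ Lp_integrable[OF r(1)]])
    show "AE t in unit_interval. (\<lambda>i. norm (r t - U i t) powr p) \<longlonglongrightarrow> 0"
    proof (rule AE_I2)
      fix t
      have "(\<lambda>i. norm (r t - U i t)) \<longlonglongrightarrow> norm (r t - r t)"
        by (intro tendsto_intros lim)
      then show "(\<lambda>i. norm (r t - U i t) powr p) \<longlonglongrightarrow> 0"
        by (intro tendsto_zero_powrI[OF _ tendsto_const]) (use p in auto)
    qed
    show "AE t in unit_interval. norm (norm (r t - U i t) powr p) \<le> norm (r t) powr p" for i
      using le[of i] U(4)[of i] r(2) p by (intro AE_I2) (auto intro!: powr_mono2)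
  qed simp_all
  then have "(\<lambda>i. Lp_norm p (\<lambda>t. r t - U i t)) \<longlonglongrightarrow> 0"
    unfolding Lp_norm_def by (intro tendsto_zero_powrI[OF _ tendsto_const]) (use p in auto)
  then have "eventually (\<lambda>i. Lp_norm p (\<lambda>t. r t - U i t) < \<delta>) sequentially"
    using \<delta> by (rule order_tendstoD(2))
  then obtain i where "Lp_norm p (\<lambda>t. r t - U i t) < \<delta>"
    using eventually_happens by force
  then show ?thesis using U(2)[of i] U(4)[of i] le[of i] by (intro exI[of _ "U i"]) auto
qed

section \<open>Unconditional convergence\<close>

text \<open>
  A rearrangement that makes given finite sets, one in each of consecutive intervals, occur as
  consecutive terms.  Partial sums of the rearranged series then differ by the sums over these sets.
\<close>

lemma bij_moving_finite_sets_to_front: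
  fixes N :: "nat \<Rightarrow> nat" and F :: "nat \<Rightarrow> nat set"
  assumes N: "strict_mono N" "N 0 = 0" and F: "\<And>k. F k \<subseteq> {N k..<N (Suc k)}"
  shows "\<exists>\<pi>. bij \<pi> \<and> (\<forall>k. bij_betw \<pi> {N k..<N k + card (F k)} (F k))"
proof -
  define I where "I k = {N k..<N (Suc k)}" for k
  have "\<exists>\<beta>. bij_betw \<beta> (I k) (I k) \<and> bij_betw \<beta> {N k..<N k + card (F k)} (F k)" for k
  proof -
    have fin: "finite (F k)" using F finite_subset by blast
    have card_le: "card (F k) \<le> card (I k)" using F by (intro card_mono) (auto simp: I_def)
    define A where "A = {N k..<N k + card (F k)}"
    have A: "A \<subseteq> I k" "card A = card (F k)" using card_le by (auto simp: A_def I_def)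
    obtain b1 where b1: "bij_betw b1 A (F k)"
      using finite_same_card_bij[of A "F k"] fin A by (auto simp: A_def)
    have "card (I k - A) = card (I k - F k)"
      using A F fin by (subst (1 2) card_Diff_subset) (auto simp: A_def I_def)
    then obtain b2 where b2: "bij_betw b2 (I k - A) (I k - F k)"
      using finite_same_card_bij[of "I k - A" "I k - F k"] by (auto simp: I_def)
    define b where "b n = (if n \<in> A then b1 n else b2 n)" for n
    have bA: "bij_betw b A (F k)"
      using b1 by (subst bij_betw_cong[of _ _ b1]) (auto simp: b_def)
    moreover have "bij_betw b (I k - A) (I k - F k)"
      using b2 by (subst bij_betw_cong[of _ _ b2]) (auto simp: b_def)
    ultimately have "bij_betw b (A \<union> (I k - A)) (F k \<union> (I k - F k))"
      by (rule bij_betw_combine) auto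
    moreover note bA
    moreover have "A \<union> (I k - A) = I k" "F k \<union> (I k - F k) = I k" using A F by (auto simp: I_def)
    ultimately show ?thesis by (auto simp: A_def)
  qed
  then obtain \<beta> where \<beta>: "\<And>k. bij_betw (\<beta> k) (I k) (I k)"
    "\<And>k. bij_betw (\<beta> k) {N k..<N k + card (F k)} (F k)" by metis
  have unique: "j = k" if "n \<in> I j" "n \<in> I k" for n j k
  proof (rule ccontr)
    assume "j \<noteq> k"
    then consider "Suc j \<le> k" | "Suc k \<le> j" by linarith
    then show False
    proof cases
      case 1
      then show False using that strict_mono_mono[OF N(1), THEN monoD, OF 1] by (auto simp: I_def)
    next
      case 2
      then show False using that strict_mono_mono[OF N(1), THEN monoD, OF 2] by (auto simp: I_def)
    qed
  qed
  have cover: "(\<Union>k. I k) = UNIV"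
  proof -
    have "\<exists>k. n \<in> I k" for n
    proof -
      define k where "k = (LEAST k. n < N (Suc k))"
      have ex: "n < N (Suc n)" using strict_mono_imp_increasing[OF N(1), of "Suc n"] by simp
      have "n < N (Suc k)" unfolding k_def by (rule LeastI[of "\<lambda>k. n < N (Suc k)", OF ex])
      moreover have "N k \<le> n"
      proof (cases k)
        case 0
        then show ?thesis using N(2) by simp
      next
        case (Suc j)
        then have "\<not> n < N (Suc j)" using not_less_Least[of j "\<lambda>k. n < N (Suc k)"] by (simp add: k_def)
        then show ?thesis using Suc by simp
      qed
      ultimately show ?thesis by (auto simp: I_def)
    qed
    then show ?thesis by blast
  qed
  define \<pi> where "\<pi> n = \<beta> (THE k. n \<in> I k) n" for n
  have \<pi>: "\<pi> n = \<beta> k n" if "n \<in> I k" for n k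
    unfolding \<pi>_def using that unique by (metis (no_types, lifting) the_equality)
  have "bij_betw \<pi> (\<Union>k. I k) (\<Union>k. I k)"
  proof (rule bij_betw_UNION_disjoint)
    show "disjoint_family_on I UNIV" using unique by (force simp: disjoint_family_on_def)
    show "bij_betw \<pi> (I k) (I k)" for k
      using \<beta>(1)[of k] \<pi> by (subst bij_betw_cong[of _ _ "\<beta> k"]) auto
  qed
  moreover have "bij_betw \<pi> {N k..<N k + card (F k)} (F k)" for k
  proof -
    have "card (F k) \<le> card (I k)" using F by (intro card_mono) (auto simp: I_def)
    then have "{N k..<N k + card (F k)} \<subseteq> I k" by (auto simp: I_def)
    then show ?thesis
      using \<beta>(2)[of k] \<pi> by (subst bij_betw_cong[of _ _ "\<beta> k"]) auto
  qed
  ultimately show ?thesis unfolding cover by blast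
qed

text \<open>
  If sums over finite sets arbitrarily far out had norm at least 1, then a rearrangement in which
  these sets occur as consecutive terms would violate the Cauchy criterion.  Hence finite sums
  beyond some \<open>N\<close> are bounded by 1, and the finitely many earlier terms add a constant.
\<close>

lemma Lp_unconditional_subset_sums_bounded:
  fixes u :: "nat \<Rightarrow> real \<Rightarrow> 'k::{real_normed_field,euclidean_space}"
  assumes p: "1 \<le> p" and u: "\<And>n. u n \<in> Lp p" and x: "x \<in> Lp p"
    and conv: "series_converges_unconditionally_to (Lp_norm p) u x"
  shows "\<exists>K. \<forall>F. finite F \<longrightarrow> Lp_norm p (\<lambda>t. \<Sum>n\<in>F. u n t) \<le> K"
proof -
  have "\<exists>N. \<forall>F. finite F \<longrightarrow> F \<subseteq> {N..} \<longrightarrow> Lp_norm p (\<lambda>t. \<Sum>n\<in>F. u n t) < 1"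
  proof (rule ccontr)
    assume "\<not> ?thesis"
    then have bad: "\<exists>F. finite F \<and> F \<subseteq> {N..} \<and> 1 \<le> Lp_norm p (\<lambda>t. \<Sum>n\<in>F. u n t)" for N
      by (meson not_less)
    define Q where "Q = (\<lambda>a b. a < b \<and> (\<exists>F. F \<subseteq> {a..<b} \<and> 1 \<le> Lp_norm p (\<lambda>t. \<Sum>n\<in>F. u n t)))"
    have "\<exists>N. \<forall>k. (k = 0 \<longrightarrow> N k = (0::nat)) \<and> Q (N k) (N (Suc k))"
    proof (rule dependent_nat_choice)
      fix a k :: nat
      obtain F where F: "finite F" "F \<subseteq> {a..}" "1 \<le> Lp_norm p (\<lambda>t. \<Sum>n\<in>F. u n t)" using bad by blast
      have "F \<subseteq> {a..<Suc (Max (insert a F))}" using F(1,2) by (auto simp: less_Suc_eq_le)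
      then have "Q a (Suc (Max (insert a F)))"
        unfolding Q_def using F by (auto simp: less_Suc_eq_le)
      then show "\<exists>b. (Suc k = 0 \<longrightarrow> b = 0) \<and> Q a b" by blast
    qed simp
    then obtain N where N: "N 0 = 0" "\<And>k. Q (N k) (N (Suc k))" by blast
    obtain F where F: "\<And>k. F k \<subseteq> {N k..<N (Suc k)}" "\<And>k. 1 \<le> Lp_norm p (\<lambda>t. \<Sum>n\<in>F k. u n t)"
      using N(2) unfolding Q_def by metis
    have sm: "strict_mono N" using N(2) by (auto simp: strict_mono_Suc_iff Q_def)
    obtain \<pi> where \<pi>: "bij \<pi>" "\<And>k. bij_betw \<pi> {N k..<N k + card (F k)} (F k)"
      using bij_moving_finite_sets_to_front[OF sm N(1) F(1)] by blast
    define S where "S m t = (\<Sum>k<m. u (\<pi> k) t)" for m t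
    have SLp: "S m \<in> Lp p" for m unfolding S_def by (rule Lp_sum(1)[OF p]) (auto intro: u)
    have lim: "(\<lambda>m. Lp_norm p (\<lambda>t. S m t - x t)) \<longlonglongrightarrow> 0"
      using conv \<pi>(1) by (auto simp: series_converges_unconditionally_to_def series_converges_to_def S_def)
    then have "eventually (\<lambda>m. Lp_norm p (\<lambda>t. S m t - x t) < 1/2) sequentially"
      by (rule order_tendstoD(2)) simp
    then obtain m0 where m0: "Lp_norm p (\<lambda>t. S m t - x t) < 1/2" if "m0 \<le> m" for m
      by (auto simp: eventually_sequentially)
    define a where "a = N m0"
    define b where "b = N m0 + card (F m0)"
    have "m0 \<le> a" unfolding a_def by (rule strict_mono_imp_increasing[OF sm])
    then have ab: "m0 \<le> a" "a \<le> b" by (auto simp: a_def b_def)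
    have "(\<Sum>n\<in>F m0. u n t) = S b t - S a t" for t
    proof -
      have "(\<Sum>n\<in>F m0. u n t) = (\<Sum>k=a..<b. u (\<pi> k) t)"
        using sum.reindex_bij_betw[OF \<pi>(2)[of m0], of "\<lambda>n. u n t"] by (simp add: a_def b_def)
      also have "\<dots> = S b t - S a t"
        unfolding S_def lessThan_atLeast0 using ab(2) sum.atLeastLessThan_concat[of 0 a b "\<lambda>k. u (\<pi> k) t"]
        by (simp add: algebra_simps)
      finally show ?thesis .
    qed
    then have "1 \<le> Lp_norm p (\<lambda>t. S b t - S a t)" using F(2)[of m0] by simp
    also have "\<dots> \<le> Lp_norm p (\<lambda>t. S b t - x t) + Lp_norm p (\<lambda>t. x t - S a t)"
      by (rule Lp_norm_diff_triangle[OF p SLp x SLp])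
    also have "\<dots> < 1/2 + 1/2"
      using m0[of a] m0[of b] ab by (intro add_strict_mono) (auto simp: Lp_norm_diff_commute[of p x])
    finally show False by simp
  qed
  then obtain N where N: "\<And>F. finite F \<Longrightarrow> F \<subseteq> {N..} \<Longrightarrow> Lp_norm p (\<lambda>t. \<Sum>n\<in>F. u n t) < 1" by blast
  define K where "K = (\<Sum>n<N. Lp_norm p (u n)) + 1"
  have "Lp_norm p (\<lambda>t. \<Sum>n\<in>F. u n t) \<le> K" if F: "finite F" for F
  proof -
    have split: "(\<Sum>n\<in>F. u n t) = (\<Sum>n\<in>F \<inter> {..<N}. u n t) + (\<Sum>n\<in>F \<inter> {N..}. u n t)" for t
    proof -
      have "F = (F \<inter> {..<N}) \<union> (F \<inter> {N..})" by auto
      then show ?thesis using F by (subst sum.union_disjoint[symmetric]) auto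
    qed
    have "Lp_norm p (\<lambda>t. \<Sum>n\<in>F. u n t) \<le> Lp_norm p (\<lambda>t. \<Sum>n\<in>F \<inter> {..<N}. u n t)
        + Lp_norm p (\<lambda>t. \<Sum>n\<in>F \<inter> {N..}. u n t)"
      unfolding split using F by (intro Lp_norm_triangle[OF p] Lp_sum(1)[OF p] u) auto
    also have "Lp_norm p (\<lambda>t. \<Sum>n\<in>F \<inter> {..<N}. u n t) \<le> (\<Sum>n\<in>F \<inter> {..<N}. Lp_norm p (u n))"
      using F by (intro Lp_sum(2)[OF p] u) auto
    also have "\<dots> \<le> (\<Sum>n<N. Lp_norm p (u n))"
      by (intro sum_mono2) (auto simp: Lp_norm_nonneg)
    finally show ?thesis using N[of "F \<inter> {N..}"] F by (auto simp: K_def)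
  qed
  then show ?thesis by blast
qed

section \<open>Unconditional expansions in non-negative functions\<close>

text \<open>
  Replacing each \<open>f\<^sub>n\<close> by its absolute value, which changes it on a null set only, turns the
  situation of the theorem into the following one, where the functions are real and non-negative
  everywhere and \<open>X\<close> is the closed linear span.
\<close>

locale nonneg_unconditional_expansion =
  fixes p :: real
    and X :: "(real \<Rightarrow> 'k::{real_normed_field,euclidean_space}) set"
    and r :: "nat \<Rightarrow> real \<Rightarrow> real"
    and g :: "nat \<Rightarrow> (real \<Rightarrow> 'k) \<Rightarrow> 'k"
  assumes p: "1 \<le> p"
    and X_Lp: "X \<subseteq> Lp p"
    and X_zero: "(\<lambda>t. 0) \<in> X"
    and X_add: "x \<in> X \<Longrightarrow> y \<in> X \<Longrightarrow> (\<lambda>t. x t + y t) \<in> X"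
    and X_scale: "x \<in> X \<Longrightarrow> (\<lambda>t. c * x t) \<in> X"
    and X_closed: "x \<in> Lp p \<Longrightarrow> (\<And>e. 0 < e \<Longrightarrow> \<exists>y\<in>X. Lp_norm p (\<lambda>t. x t - y t) < e) \<Longrightarrow> x \<in> X"
    and r_Lp: "r n \<in> Lp p"
    and r_nonneg: "0 \<le> r n t"
    and g_add: "x \<in> X \<Longrightarrow> y \<in> X \<Longrightarrow> g n (\<lambda>t. x t + y t) = g n x + g n y"
    and g_scale: "x \<in> X \<Longrightarrow> g n (\<lambda>t. c * x t) = c * g n x"
    and g_bounded: "\<exists>C. \<forall>x\<in>X. norm (g n x) \<le> C * Lp_norm p x"
    and expansion: "x \<in> X \<Longrightarrow>
      series_converges_unconditionally_to (Lp_norm p) (\<lambda>n t. g n x * of_real (r n t)) x"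
begin

lemma X_diff: "x \<in> X \<Longrightarrow> y \<in> X \<Longrightarrow> (\<lambda>t. x t - y t) \<in> X"
  using X_add[of x "\<lambda>t. -1 * y t"] X_scale[of y "-1"] by simp

lemma g_diff: "x \<in> X \<Longrightarrow> y \<in> X \<Longrightarrow> g n (\<lambda>t. x t - y t) = g n x - g n y"
  using g_add[of x "\<lambda>t. -1 * y t" n] g_scale[of y n "-1"] X_scale[of y "-1"] by simp

definition gbound :: "nat \<Rightarrow> real" where
  "gbound n = (SOME C. 0 \<le> C \<and> (\<forall>x\<in>X. norm (g n x) \<le> C * Lp_norm p x))"

lemma gbound: "0 \<le> gbound n" "x \<in> X \<Longrightarrow> norm (g n x) \<le> gbound n * Lp_norm p x"
proof -
  obtain C where C: "\<forall>x\<in>X. norm (g n x) \<le> C * Lp_norm p x" using g_bounded by blast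
  have "norm (g n x) \<le> max 0 C * Lp_norm p x" if "x \<in> X" for x
  proof -
    have "norm (g n x) \<le> C * Lp_norm p x" using C that by blast
    also have "\<dots> \<le> max 0 C * Lp_norm p x"
      by (intro mult_right_mono) (auto simp: Lp_norm_nonneg)
    finally show ?thesis .
  qed
  then have "\<exists>C. 0 \<le> C \<and> (\<forall>x\<in>X. norm (g n x) \<le> C * Lp_norm p x)"
    by (intro exI[of _ "max 0 C"]) auto
  from someI_ex[OF this] show "0 \<le> gbound n" "x \<in> X \<Longrightarrow> norm (g n x) \<le> gbound n * Lp_norm p x"
    by (auto simp: gbound_def)
qed

lemma term_Lp: "(\<lambda>t. a * of_real (r n t) :: 'k) \<in> Lp p"
  by (intro Lp_cmult Lp_of_real r_Lp)

lemma norm_term: "Lp_norm p (\<lambda>t. a * of_real (r n t) :: 'k) = norm a * Lp_norm p (r n)"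
  by (simp add: Lp_norm_cmult[OF p] Lp_norm_of_real)

definition modulus_sum :: "nat set \<Rightarrow> (real \<Rightarrow> 'k) \<Rightarrow> real \<Rightarrow> real" where
  "modulus_sum F x t = (\<Sum>n\<in>F. norm (g n x) * r n t)"

lemma modulus_sum_nonneg: "0 \<le> modulus_sum F x t"
  by (auto simp: modulus_sum_def r_nonneg intro!: sum_nonneg)

lemma modulus_sum_Lp: "finite F \<Longrightarrow> modulus_sum F x \<in> Lp p"
  unfolding modulus_sum_def[abs_def] by (intro Lp_sum(1) Lp_cmult r_Lp p)

text \<open>
  This is where non-negativity enters: an unconditional expansion in non-negative functions even
  converges absolutely in the lattice sense.  Finite partial sums are uniformly bounded operators
  by the uniform boundedness principle.  For the sums with \<open>norm (g n x)\<close> in place of \<open>g n x\<close>,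
  split the scalars into coordinates and each coordinate according to its sign; because \<open>r n\<close> is
  non-negative, the sum over each part is, up to sign, a coordinate of a partial sum of the expansion.
\<close>

lemma modulus_sum_bound:
  "\<exists>K\<ge>0. \<forall>F. finite F \<longrightarrow> (\<forall>x\<in>X. Lp_norm p (modulus_sum F x) \<le> K * Lp_norm p x)"
proof -
  define S where "S F x t = (\<Sum>n\<in>F. g n x * of_real (r n t))" for F x t
  have SLp: "S F x \<in> Lp p" if "finite F" for F x
    unfolding S_def[abs_def] by (intro Lp_sum(1)[OF p that] term_Lp)
  have "\<exists>K\<ge>0. \<forall>F\<in>Collect finite. \<forall>x\<in>X. Lp_norm p (S F x) \<le> K * Lp_norm p x"
  proof (rule Lp_uniform_boundedness[OF p X_Lp X_zero X_add X_scale X_closed])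
    fix F :: "nat set" assume "F \<in> Collect finite"
    then have F: "finite F" by simp
    show "Lp_norm p (S F (\<lambda>t. x t + y t)) \<le> Lp_norm p (S F x) + Lp_norm p (S F y)"
      if "x \<in> X" "y \<in> X" for x y
    proof -
      have "S F (\<lambda>t. x t + y t) = (\<lambda>t. S F x t + S F y t)"
        by (simp add: S_def fun_eq_iff g_add that distrib_right sum.distrib)
      then show ?thesis using Lp_norm_triangle[OF p SLp[OF F] SLp[OF F], of x y] by simp
    qed
    show "Lp_norm p (S F (\<lambda>t. c * x t)) = norm c * Lp_norm p (S F x)" if "x \<in> X" for c x
    proof -
      have "S F (\<lambda>t. c * x t) = (\<lambda>t. c * S F x t)"
        by (simp add: S_def fun_eq_iff g_scale that sum_distrib_left mult.assoc)
      then show ?thesis by (simp add: Lp_norm_cmult[OF p])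
    qed
    have "Lp_norm p (S F x) \<le> (\<Sum>n\<in>F. gbound n * Lp_norm p (r n)) * Lp_norm p x" if "x \<in> X" for x
    proof -
      have "Lp_norm p (S F x) \<le> (\<Sum>n\<in>F. Lp_norm p (\<lambda>t. g n x * of_real (r n t)))"
        unfolding S_def[abs_def] by (intro Lp_sum(2)[OF p F] term_Lp)
      also have "\<dots> \<le> (\<Sum>n\<in>F. gbound n * Lp_norm p x * Lp_norm p (r n))"
        unfolding norm_term using gbound(2)[OF that]
        by (intro sum_mono mult_right_mono) (auto simp: Lp_norm_nonneg)
      finally show ?thesis by (simp add: sum_distrib_left mult_ac)
    qed
    then show "\<exists>C. \<forall>x\<in>X. Lp_norm p (S F x) \<le> C * Lp_norm p x" by blast
  next
    fix x assume x: "x \<in> X"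
    show "\<exists>B. \<forall>F\<in>Collect finite. Lp_norm p (S F x) \<le> B"
      using Lp_unconditional_subset_sums_bounded[OF p term_Lp _ expansion[OF x]] x X_Lp
      by (auto simp: S_def[abs_def])
  qed auto
  then obtain K where K: "0 \<le> K" "\<And>F x. finite F \<Longrightarrow> x \<in> X \<Longrightarrow> Lp_norm p (S F x) \<le> K * Lp_norm p x"
    by auto
  have "Lp_norm p (modulus_sum F x) \<le> (real DIM('k) * (2 * K)) * Lp_norm p x"
    if F: "finite F" and x: "x \<in> X" for F x
  proof -
    define P where "P b = {n \<in> F. 0 \<le> g n x \<bullet> b}" for b
    define M where "M b = {n \<in> F. \<not> 0 \<le> g n x \<bullet> b}" for b
    have fin: "finite (P b)" "finite (M b)" for b using F by (auto simp: P_def M_def)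
    define D where "D t = (\<Sum>b\<in>(Basis::'k set). norm (S (P b) x t) + norm (S (M b) x t))" for t
    have normLp: "(\<lambda>t. norm (S F x t)) \<in> Lp p" "Lp_norm p (\<lambda>t. norm (S F x t)) = Lp_norm p (S F x)"
      if "finite F" for F
      using SLp[OF that, of x] by (auto simp: Lp_def Lp_norm_def)
    have DLp: "D \<in> Lp p" unfolding D_def[abs_def]
      by (intro Lp_sum(1)[OF p] Lp_add[OF p] normLp fin finite_Basis)
    have inner: "S F x t \<bullet> b = (\<Sum>n\<in>F. (g n x \<bullet> b) * r n t)" for F t b
      unfolding S_def inner_sum_left
      by (intro sum.cong refl) (metis inner_scaleR_left mult.commute scaleR_conv_of_real)
    have pw: "modulus_sum F x t \<le> D t" for t
    proof -
      have "modulus_sum F x t \<le> (\<Sum>n\<in>F. (\<Sum>b\<in>Basis. \<bar>g n x \<bullet> b\<bar>) * r n t)"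
        unfolding modulus_sum_def by (intro sum_mono mult_right_mono norm_le_l1 r_nonneg)
      also have "\<dots> = (\<Sum>b\<in>Basis. \<Sum>n\<in>F. \<bar>g n x \<bullet> b\<bar> * r n t)"
        unfolding sum_distrib_right by (rule sum.swap)
      also have "\<dots> \<le> D t"
        unfolding D_def
      proof (rule sum_mono)
        fix b :: 'k assume b: "b \<in> Basis"
        have "(\<Sum>n\<in>F. \<bar>g n x \<bullet> b\<bar> * r n t)
            = (\<Sum>n\<in>P b. \<bar>g n x \<bullet> b\<bar> * r n t) + (\<Sum>n\<in>M b. \<bar>g n x \<bullet> b\<bar> * r n t)"
          unfolding P_def M_def using F
          by (subst sum.union_disjoint[symmetric]) (auto intro!: sum.cong)
        also have "(\<Sum>n\<in>P b. \<bar>g n x \<bullet> b\<bar> * r n t) = S (P b) x t \<bullet> b"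
          unfolding inner by (intro sum.cong) (auto simp: P_def)
        also have "(\<Sum>n\<in>M b. \<bar>g n x \<bullet> b\<bar> * r n t) = - (S (M b) x t \<bullet> b)"
          unfolding inner sum_negf[symmetric] by (intro sum.cong) (auto simp: M_def)
        also have "S (P b) x t \<bullet> b + - (S (M b) x t \<bullet> b) \<le> norm (S (P b) x t) + norm (S (M b) x t)"
          using Basis_le_norm[OF b, of "S (P b) x t"] Basis_le_norm[OF b, of "S (M b) x t"] by linarith
        finally show "(\<Sum>n\<in>F. \<bar>g n x \<bullet> b\<bar> * r n t) \<le> norm (S (P b) x t) + norm (S (M b) x t)" .
      qed
      finally show ?thesis .
    qed
    have "Lp_norm p (modulus_sum F x) \<le> Lp_norm p D"
    proof (rule Lp_dominated(2)[OF p DLp])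
      show "modulus_sum F x \<in> borel_measurable unit_interval"
        using modulus_sum_Lp[OF F] by (simp add: Lp_def)
      show "AE t in unit_interval. norm (modulus_sum F x t) \<le> norm (D t)"
        using pw modulus_sum_nonneg[of F x] by (intro AE_I2) (simp add: order_trans[OF pw abs_ge_self])
    qed
    also have "\<dots> \<le> (\<Sum>b\<in>(Basis::'k set). Lp_norm p (\<lambda>t. norm (S (P b) x t) + norm (S (M b) x t)))"
      unfolding D_def[abs_def] by (intro Lp_sum(2)[OF p] Lp_add[OF p] normLp fin finite_Basis)
    also have "\<dots> \<le> (\<Sum>b\<in>(Basis::'k set). K * Lp_norm p x + K * Lp_norm p x)"
    proof (rule sum_mono)
      fix b :: 'k
      have "Lp_norm p (\<lambda>t. norm (S (P b) x t) + norm (S (M b) x t))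
          \<le> Lp_norm p (\<lambda>t. norm (S (P b) x t)) + Lp_norm p (\<lambda>t. norm (S (M b) x t))"
        by (intro Lp_norm_triangle[OF p] normLp fin)
      also have "\<dots> \<le> K * Lp_norm p x + K * Lp_norm p x"
        unfolding normLp(2)[OF fin(1)] normLp(2)[OF fin(2)] by (intro add_mono K(2) fin x)
      finally show "Lp_norm p (\<lambda>t. norm (S (P b) x t) + norm (S (M b) x t))
          \<le> K * Lp_norm p x + K * Lp_norm p x" .
    qed
    finally show ?thesis by (simp add: algebra_simps)
  qed
  then show ?thesis using K(1) by (intro exI[of _ "real DIM('k) * (2 * K)"]) auto
qed

end

section \<open>Uniformly small tails\<close>

lemma Lp_clarkson:
  fixes x y :: "real \<Rightarrow> 'k::{real_normed_field,euclidean_space}"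
  assumes p: "1 \<le> p" and x: "x \<in> Lp p" and y: "y \<in> Lp p"
  shows "Lp_norm p (\<lambda>t. x t + y t) powr p + Lp_norm p (\<lambda>t. x t - y t) powr p
       \<le> 2 * clarkson_const p * (Lp_norm p x powr p + Lp_norm p y powr p)"
proof -
  note int = Lp_integrable[OF x] Lp_integrable[OF y]
    Lp_integrable[OF Lp_add[OF p x y]] Lp_integrable[OF Lp_diff[OF p x y]]
  have "(\<integral>t. norm (x t + y t) powr p + norm (x t - y t) powr p \<partial>unit_interval)
      \<le> (\<integral>t. 2 * clarkson_const p * (norm (x t) powr p + norm (y t) powr p) \<partial>unit_interval)"
    by (intro integral_mono clarkson_inequality p Bochner_Integration.integrable_add
        integrable_mult_right int)
  then show ?thesis using int by (simp add: Lp_norm_powr[OF p])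
qed

lemma Lp_norm_sum_diff_le:
  fixes x y :: "real \<Rightarrow> 'k::{real_normed_field,euclidean_space}"
  assumes p: "1 \<le> p" and x: "x \<in> Lp p" and y: "y \<in> Lp p" and one: "Lp_norm p x = 1" "Lp_norm p y = 1"
  shows "Lp_norm p (\<lambda>t. x t + y t) + Lp_norm p (\<lambda>t. x t - y t)
       \<le> 2 * (2 * clarkson_const p) powr (1 / p)"
proof -
  define a where "a = Lp_norm p (\<lambda>t. x t + y t)"
  define b where "b = Lp_norm p (\<lambda>t. x t - y t)"
  have ab: "0 \<le> a" "0 \<le> b" by (auto simp: a_def b_def Lp_norm_nonneg)
  have "((a + b) / 2) powr p \<le> (a powr p + b powr p) / 2"
    using powr_convex_nonneg[of p a b "1/2"] p ab by (simp add: field_simps)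
  also have "\<dots> \<le> 2 * clarkson_const p"
    using Lp_clarkson[OF p x y] by (simp add: one a_def b_def)
  finally have "(((a + b) / 2) powr p) powr (1 / p) \<le> (2 * clarkson_const p) powr (1 / p)"
    using p by (intro powr_mono2) auto
  then show ?thesis using p ab by (simp add: powr_powr a_def b_def)
qed

context nonneg_unconditional_expansion
begin

definition weight :: "nat \<Rightarrow> real" where
  "weight n = (\<integral>t. r n t \<partial>unit_interval)"

lemma weight_nonneg: "0 \<le> weight n"
  by (simp add: weight_def r_nonneg)

lemma integral_modulus_sum:
  assumes "finite F"
  shows "(\<integral>t. modulus_sum F x t \<partial>unit_interval) = (\<Sum>n\<in>F. norm (g n x) * weight n)"
  unfolding modulus_sum_def weight_def
  using Lp_imp_integrable(1)[OF p r_Lp] by (subst Bochner_Integration.integral_sum) auto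

text \<open>
  The operator \<open>x \<mapsto> (g n x * weight n)\<^sub>n\<close> from \<open>X\<close> to \<open>\<ell>\<^sub>1\<close> is compact if \<open>p > 1\<close>, and the lemma
  states this as uniform smallness of tails.  Let \<open>D\<close> be the infimum of all constants that bound
  some tail.  If \<open>D > 0\<close>, take a tail bounded by \<open>\<rho>\<close> slightly larger than \<open>D\<close>, and two unit vectors
  \<open>x\<close> and \<open>y\<close> whose \<open>\<ell>\<^sub>1\<close> masses on disjoint parts of that tail exceed \<open>\<sigma>\<close>, slightly smaller than
  \<open>D\<close>.  On average over the sign, \<open>x \<plusminus> y\<close> has mass at least \<open>2 * \<sigma>\<close> there, but by Clarkson's
  inequality its norm is on average at most a constant \<open>\<kappa> < 2\<close>, so its mass is at most \<open>\<rho> * \<kappa>\<close>.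
\<close>

lemma weighted_tails_small:
  assumes p1: "1 < p" and \<epsilon>: "0 < \<epsilon>"
  shows "\<exists>N. \<forall>x\<in>X. \<forall>M. (\<Sum>n=N..<M. norm (g n x) * weight n) \<le> \<epsilon> * Lp_norm p x"
proof -
  define TB where "TB N \<rho> \<longleftrightarrow> (\<forall>x\<in>X. \<forall>M. (\<Sum>n=N..<M. norm (g n x) * weight n) \<le> \<rho> * Lp_norm p x)" for N \<rho>
  define R where "R = {\<rho>. 0 \<le> \<rho> \<and> (\<exists>N. TB N \<rho>)}"
  obtain K where K: "0 \<le> K"
    "\<And>F x. finite F \<Longrightarrow> x \<in> X \<Longrightarrow> Lp_norm p (modulus_sum F x) \<le> K * Lp_norm p x"
    using modulus_sum_bound by blast
  have TBK: "TB N (2 * K)" for N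
    unfolding TB_def
  proof (intro ballI allI)
    fix x M assume x: "x \<in> X"
    have "(\<Sum>n=N..<M. norm (g n x) * weight n) = (\<integral>t. norm (modulus_sum {N..<M} x t) \<partial>unit_interval)"
      by (simp add: integral_modulus_sum modulus_sum_nonneg)
    also have "\<dots> \<le> 2 * Lp_norm p (modulus_sum {N..<M} x)"
      by (intro Lp_imp_integrable(2)[OF p] modulus_sum_Lp) simp
    also have "\<dots> \<le> 2 * (K * Lp_norm p x)"
      by (intro mult_left_mono K(2) x) auto
    finally show "(\<Sum>n=N..<M. norm (g n x) * weight n) \<le> 2 * K * Lp_norm p x" by simp
  qed
  have Rne: "R \<noteq> {}" using TBK K(1) by (auto simp: R_def intro: exI[of _ "2 * K"])
  have Rbdd: "bdd_below R" by (auto simp: R_def intro: bdd_belowI)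
  define D where "D = Inf R"
  have D0: "0 \<le> D" unfolding D_def by (rule cInf_greatest[OF Rne]) (auto simp: R_def)
  have "D = 0"
  proof (rule ccontr)
    assume "D \<noteq> 0"
    then have D: "0 < D" using D0 by simp
    define \<kappa> where "\<kappa> = (2 * clarkson_const p) powr (1 / p)"
    have c1: "1 \<le> clarkson_const p" by (simp add: clarkson_const_def)
    have \<kappa>0: "0 < \<kappa>" using c1 by (simp add: \<kappa>_def)
    have \<kappa>2: "\<kappa> < 2"
    proof -
      have "2 * clarkson_const p < 2 * 2 powr (p - 1)"
        using clarkson_const_strict[OF p1] by simp
      also have "\<dots> = 2 powr p" by (simp add: powr_diff)
      finally have "\<kappa> < (2 powr p) powr (1 / p)"
        unfolding \<kappa>_def using c1 p1 by (intro powr_less_mono2) auto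
      then show ?thesis using p1 by (simp add: powr_powr)
    qed
    \<comment> \<open>Any \<open>\<sigma>\<close> with \<open>\<kappa> / 2 * D < \<sigma> < D\<close> leaves room for \<open>\<rho> > D\<close> with \<open>\<rho> * \<kappa> < 2 * \<sigma>\<close>.\<close>
    define \<sigma> where "\<sigma> = D * (1 + \<kappa> / 2) / 2"
    have "0 < \<sigma>" using D \<kappa>0 by (simp add: \<sigma>_def add_pos_pos)
    moreover have "\<sigma> < D" using D \<kappa>2 by (simp add: \<sigma>_def field_simps)
    ultimately have \<sigma>: "0 < \<sigma>" "\<sigma> < D" by auto
    have "D < 2 * \<sigma> / \<kappa>" using D \<kappa>0 \<kappa>2 by (simp add: \<sigma>_def field_simps)
    then obtain \<rho> where \<rho>: "\<rho> \<in> R" "\<rho> < 2 * \<sigma> / \<kappa>"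
      unfolding D_def using cInf_lessD[OF Rne] by blast
    obtain N where N: "TB N \<rho>" "0 \<le> \<rho>" using \<rho>(1) by (auto simp: R_def)
    have big: "\<exists>x\<in>X. Lp_norm p x = 1 \<and> (\<exists>M. \<sigma> < (\<Sum>n=L..<M. norm (g n x) * weight n))" for L
    proof -
      have "\<not> TB L \<sigma>"
      proof
        assume "TB L \<sigma>"
        then have "D \<le> \<sigma>" unfolding D_def using \<sigma>(1) by (intro cInf_lower[OF _ Rbdd]) (auto simp: R_def)
        then show False using \<sigma>(2) by simp
      qed
      then obtain x M where x: "x \<in> X" "\<sigma> * Lp_norm p x < (\<Sum>n=L..<M. norm (g n x) * weight n)"
        by (auto simp: TB_def not_le)
      have "Lp_norm p x \<noteq> 0"
      proof
        assume "Lp_norm p x = 0"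
        moreover have "(\<Sum>n=L..<M. norm (g n x) * weight n) \<le> 2 * K * Lp_norm p x"
          using TBK[of L] x(1) unfolding TB_def by blast
        ultimately show False using x(2) by simp
      qed
      then have nx: "0 < Lp_norm p x" using Lp_norm_nonneg[of p x] by simp
      define y where "y t = of_real (1 / Lp_norm p x) * x t" for t
      have y: "y \<in> X" unfolding y_def[abs_def] by (rule X_scale[OF x(1)])
      have "Lp_norm p y = 1"
        unfolding y_def[abs_def] Lp_norm_cmult[OF p] using nx by (simp add: norm_divide)
      moreover have "norm (g n y) = norm (g n x) / Lp_norm p x" for n
        unfolding y_def[abs_def] g_scale[OF x(1)] using nx by (simp add: norm_mult norm_divide)
      then have "(\<Sum>n=L..<M. norm (g n y) * weight n) = (\<Sum>n=L..<M. norm (g n x) * weight n) / Lp_norm p x"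
        by (simp add: sum_divide_distrib)
      then have "\<sigma> < (\<Sum>n=L..<M. norm (g n y) * weight n)"
        using x(2) nx by (simp add: pos_less_divide_eq)
      ultimately show ?thesis using y by blast
    qed
    obtain x M where x: "x \<in> X" "Lp_norm p x = 1" "\<sigma> < (\<Sum>n=N..<M. norm (g n x) * weight n)"
      using big by blast
    obtain y L where y: "y \<in> X" "Lp_norm p y = 1" "\<sigma> < (\<Sum>n=M..<L. norm (g n y) * weight n)"
      using big by blast
    have "N < M" using x(3) \<sigma>(1) by (cases "N < M") auto
    have "M < L" using y(3) \<sigma>(1) by (cases "M < L") auto
    let ?G = "\<lambda>n. norm (g n (\<lambda>t. x t + y t)) + norm (g n (\<lambda>t. x t - y t))"
    have Gx: "2 * norm (g n x) \<le> ?G n" for n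
      using norm_triangle_ineq[of "g n x + g n y" "g n x - g n y"] norm_scaleR[of 2 "g n x"]
      by (simp add: g_add[OF x(1) y(1)] g_diff[OF x(1) y(1)] scaleR_2)
    have Gy: "2 * norm (g n y) \<le> ?G n" for n
      using norm_triangle_ineq4[of "g n x + g n y" "g n x - g n y"] norm_scaleR[of 2 "g n y"]
      by (simp add: g_add[OF x(1) y(1)] g_diff[OF x(1) y(1)] scaleR_2)
    have "4 * \<sigma> < 2 * (\<Sum>n=N..<M. norm (g n x) * weight n) + 2 * (\<Sum>n=M..<L. norm (g n y) * weight n)"
      using x(3) y(3) by simp
    also have "\<dots> = (\<Sum>n=N..<M. (2 * norm (g n x)) * weight n) + (\<Sum>n=M..<L. (2 * norm (g n y)) * weight n)"
      by (simp add: sum_distrib_left mult.assoc)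
    also have "\<dots> \<le> (\<Sum>n=N..<M. ?G n * weight n) + (\<Sum>n=M..<L. ?G n * weight n)"
      by (intro add_mono sum_mono mult_right_mono Gx Gy weight_nonneg)
    also have "\<dots> = (\<Sum>n=N..<L. ?G n * weight n)"
      using \<open>N < M\<close> \<open>M < L\<close> by (intro sum.atLeastLessThan_concat) auto
    also have "\<dots> \<le> \<rho> * Lp_norm p (\<lambda>t. x t + y t) + \<rho> * Lp_norm p (\<lambda>t. x t - y t)"
      using N(1) X_add[OF x(1) y(1)] X_diff[OF x(1) y(1)]
      unfolding TB_def distrib_right sum.distrib by (intro add_mono) auto
    also have "\<dots> \<le> \<rho> * (2 * \<kappa>)"
      using Lp_norm_sum_diff_le[OF p _ _ x(2) y(2)] x(1) y(1) X_Lp N(2)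
      unfolding \<kappa>_def distrib_left[symmetric] by (intro mult_left_mono) auto
    finally have "2 * \<sigma> < \<rho> * \<kappa>" by (simp add: mult.commute)
    moreover have "\<rho> * \<kappa> < 2 * \<sigma>" using \<rho>(2) \<kappa>0 by (simp add: field_simps)
    ultimately show False by simp
  qed
  then obtain \<rho> where \<rho>: "\<rho> \<in> R" "\<rho> < \<epsilon>" using cInf_lessD[OF Rne, of \<epsilon>] \<epsilon> by (auto simp: D_def)
  then obtain N where N: "TB N \<rho>" by (auto simp: R_def)
  have "(\<Sum>n=N..<M. norm (g n x) * weight n) \<le> \<epsilon> * Lp_norm p x" if "x \<in> X" for x M
  proof -
    have "(\<Sum>n=N..<M. norm (g n x) * weight n) \<le> \<rho> * Lp_norm p x" using N that by (auto simp: TB_def)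
    also have "\<dots> \<le> \<epsilon> * Lp_norm p x" using \<rho>(2) by (intro mult_right_mono Lp_norm_nonneg) simp
    finally show ?thesis .
  qed
  then show ?thesis by blast
qed

end

section \<open>Blocking\<close>

text \<open>
  The interaction of a term is measured only against the terms before its predecessor.  If \<open>u K\<close>
  exceeds the sum of those terms, then that sum is the interaction itself and the
  remaining two terms are at most \<open>m\<close> each; otherwise \<open>u K\<close> is its own interaction.
\<close>

lemma sum_le_max_plus_interaction:
  fixes u :: "nat \<Rightarrow> real"
  assumes "\<And>k. k < K \<Longrightarrow> 0 \<le> u k" "\<And>k. k < K \<Longrightarrow> u k \<le> m" "0 \<le> m"
  shows "(\<Sum>k<K. u k) \<le> 2 * m + (\<Sum>k<K. min (u k) (\<Sum>j<k-1. u j))"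
  using assms(1,2)
proof (induction K)
  case 0
  then show ?case using \<open>0 \<le> m\<close> by simp
next
  case (Suc K)
  define err where "err k = min (u k) (\<Sum>j<k-1. u j)" for k
  have IH: "(\<Sum>k<K. u k) \<le> 2 * m + (\<Sum>k<K. err k)" using Suc by (simp add: err_def)
  have err0: "0 \<le> err k" if "k < Suc K" for k
    unfolding err_def using that Suc.prems(1) by (auto intro!: sum_nonneg)
  have "(\<Sum>k<Suc K. u k) \<le> 2 * m + (\<Sum>k<Suc K. err k)"
  proof (cases "u K \<le> (\<Sum>j<K-1. u j)")
    case True
    then show ?thesis using IH by (simp add: err_def)
  next
    case False
    then have eK: "err K = (\<Sum>j<K-1. u j)" by (simp add: err_def)
    have "(\<Sum>k<K. u k) \<le> m + (\<Sum>j<K-1. u j)"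
    proof (cases K)
      case 0
      then show ?thesis using \<open>0 \<le> m\<close> by simp
    next
      case (Suc K')
      then show ?thesis using Suc.prems(2)[of K'] by simp
    qed
    moreover have "0 \<le> (\<Sum>k<K. err k)" by (intro sum_nonneg err0) simp
    ultimately show ?thesis using Suc.prems(2)[of K] eK by simp
  qed
  then show ?case by (simp add: err_def)
qed

lemma sum_blocks:
  fixes N :: "nat \<Rightarrow> nat" and a :: "nat \<Rightarrow> 'b::comm_monoid_add"
  assumes "mono N" "N 0 = 0"
  shows "(\<Sum>k<K. \<Sum>n=N k..<N (Suc k). a n) = (\<Sum>n<N K. a n)"
proof (induction K)
  case (Suc K)
  have "N K \<le> N (Suc K)" using assms(1) by (simp add: monoD)
  then show ?case
    using Suc sum.atLeastLessThan_concat[of 0 "N K" "N (Suc K)" a] by (simp add: lessThan_atLeast0)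
qed (simp add: assms)

context nonneg_unconditional_expansion
begin

definition block :: "(nat \<Rightarrow> nat) \<Rightarrow> (nat \<Rightarrow> real \<Rightarrow> real) \<Rightarrow> nat \<Rightarrow> (real \<Rightarrow> 'k) \<Rightarrow> real \<Rightarrow> 'k" where
  "block N s k x t = (\<Sum>n=N k..<N (Suc k). g n x * of_real (s n t))"

lemma block_scale: "x \<in> X \<Longrightarrow> block N s k (\<lambda>t. c * x t) t = c * block N s k x t"
  by (simp add: block_def g_scale sum_distrib_left mult.assoc)

text \<open>
  By the smallness of tails, \<open>N (k + 1)\<close> can be chosen so large that everything from there on is
  almost disjoint from what comes before \<open>N k\<close>.  The gap between \<open>N k\<close> and \<open>N (k + 1)\<close> cannot be
  avoided, because adjacent blocks may overlap.
\<close>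

lemma blocks_exist:
  assumes p1: "1 < p" and \<eta>: "\<And>k. 0 < \<eta> k"
  shows "\<exists>N. strict_mono N \<and> N 0 = 0 \<and> (\<forall>k. \<forall>x\<in>X. Lp_norm p x = 1 \<longrightarrow> (\<forall>L.
    Lp_norm p (\<lambda>t. min (\<Sum>n<N k. gbound n * r n t) (modulus_sum {N (Suc k)..<L} x t)) \<le> \<eta> k))"
proof -
  define Q where "Q = (\<lambda>k a b. a < b \<and> (\<forall>x\<in>X. Lp_norm p x = 1 \<longrightarrow> (\<forall>L.
    Lp_norm p (\<lambda>t. min (\<Sum>n<a. gbound n * r n t) (modulus_sum {b..<L} x t)) \<le> \<eta> k)))"
  have "\<exists>N. \<forall>k. (k = 0 \<longrightarrow> N k = (0::nat)) \<and> Q k (N k) (N (Suc k))"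
  proof (rule dependent_nat_choice)
    fix a k :: nat
    define G where "G t = (\<Sum>n<a. gbound n * r n t)" for t
    have G: "G \<in> Lp p" "\<And>t. 0 \<le> G t"
      unfolding G_def[abs_def]
      by (auto intro!: Lp_sum(1)[OF p] Lp_cmult r_Lp sum_nonneg mult_nonneg_nonneg gbound(1) r_nonneg)
    obtain \<epsilon> where \<epsilon>: "0 < \<epsilon>" "\<And>y. y \<in> Lp p \<Longrightarrow> (\<forall>t. 0 \<le> y t) \<Longrightarrow>
        (\<integral>t. y t \<partial>unit_interval) \<le> \<epsilon> \<Longrightarrow> Lp_norm p (\<lambda>t. min (G t) (y t)) \<le> \<eta> k"
      using Lp_norm_min_small[OF p G \<eta>[of k]] by blast
    obtain N where N: "\<And>x M. x \<in> X \<Longrightarrow> (\<Sum>n=N..<M. norm (g n x) * weight n) \<le> \<epsilon> * Lp_norm p x"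
      using weighted_tails_small[OF p1 \<epsilon>(1)] by blast
    define b where "b = max N (Suc a)"
    have "Lp_norm p (\<lambda>t. min (G t) (modulus_sum {b..<L} x t)) \<le> \<eta> k"
      if x: "x \<in> X" "Lp_norm p x = 1" for x L
    proof (rule \<epsilon>(2)[OF modulus_sum_Lp])
      have "(\<integral>t. modulus_sum {b..<L} x t \<partial>unit_interval) = (\<Sum>n=b..<L. norm (g n x) * weight n)"
        by (rule integral_modulus_sum) simp
      also have "\<dots> \<le> (\<Sum>n=N..<L. norm (g n x) * weight n)"
        by (intro sum_mono2) (auto simp: b_def weight_nonneg)
      finally show "(\<integral>t. modulus_sum {b..<L} x t \<partial>unit_interval) \<le> \<epsilon>"
        using N[OF x(1), of L] x(2) by simp
    qed (auto simp: modulus_sum_nonneg)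
    then have "Q k a b" by (auto simp: Q_def b_def G_def)
    then show "\<exists>b. (Suc k = 0 \<longrightarrow> b = 0) \<and> Q k a b" by blast
  qed simp
  then obtain N where N: "N 0 = 0" "\<And>k. Q k (N k) (N (Suc k))" by blast
  then show ?thesis by (intro exI[of _ N]) (auto simp: strict_mono_Suc_iff Q_def)
qed

lemma simple_approximants_exist:
  assumes "\<And>n. 0 < \<delta> n"
  shows "\<exists>s. (\<forall>n. simple_function unit_interval (s n)) \<and> (\<forall>n t. 0 \<le> s n t \<and> s n t \<le> r n t)
    \<and> (\<forall>n. gbound n * Lp_norm p (\<lambda>t. r n t - s n t) \<le> \<delta> n)"
proof -
  have "\<exists>s. simple_function unit_interval s \<and> (\<forall>t. 0 \<le> s t \<and> s t \<le> r n t)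
      \<and> gbound n * Lp_norm p (\<lambda>t. r n t - s t) \<le> \<delta> n" for n
  proof -
    have pos: "0 < gbound n + 1" using gbound(1)[of n] by simp
    obtain s where s: "simple_function unit_interval s" "\<forall>t. 0 \<le> s t \<and> s t \<le> r n t"
      "Lp_norm p (\<lambda>t. r n t - s t) \<le> \<delta> n / (gbound n + 1)"
      using Lp_simple_approximation_below[OF p r_Lp r_nonneg, of "\<delta> n / (gbound n + 1)" n] assms[of n] pos
      by auto
    have "gbound n * Lp_norm p (\<lambda>t. r n t - s t) \<le> (gbound n + 1) * (\<delta> n / (gbound n + 1))"
      using s(3) gbound(1)[of n] by (intro mult_mono) (auto simp: Lp_norm_nonneg)
    then show ?thesis using s pos by auto
  qed
  then show ?thesis by metis
qed

text \<open>
  The lower estimate.  Replacing \<open>r n\<close> by \<open>s n\<close> costs at most \<open>1/8\<close> for a unit vector.  For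
  \<open>p = 1\<close> the triangle inequality is already the estimate, with singletons as blocks.  For \<open>p > 1\<close>
  choose almost disjoint blocks: pointwise, the sum of the block functions is then at most twice
  their maximum plus the interactions, whose norms are summable with a small sum, and the maximum
  is dominated by the \<open>\<ell>\<^sub>p\<close> sum \<open>m\<close>, whose norm is the \<open>\<ell>\<^sub>p\<close> sum of the norms.
\<close>

lemma block_lower_bound:
  "\<exists>N s. strict_mono N \<and> N 0 = 0 \<and> (\<forall>n. simple_function unit_interval (s n))
    \<and> (\<forall>n t. 0 \<le> s n t \<and> s n t \<le> r n t)
    \<and> (\<forall>x\<in>X. \<forall>B\<ge>0. (\<forall>K. (\<Sum>k<K. Lp_norm p (block N s k x) powr p) \<le> B powr p)
         \<longrightarrow> Lp_norm p x \<le> 4 * B)"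
proof -
  define \<eta> :: "nat \<Rightarrow> real" where "\<eta> k = (1/16) * (1/2) ^ k" for k
  have \<eta>0: "0 < \<eta> k" for k by (simp add: \<eta>_def)
  have \<eta>sum: "(\<Sum>k<K. \<eta> k) \<le> 1/8" for K
  proof -
    have "(\<Sum>k<K. \<eta> k) = (1/16) * (2 * (1 - (1/2) ^ K))"
      unfolding \<eta>_def sum_distrib_left[symmetric] by (subst geometric_sum) auto
    also have "\<dots> \<le> (1/16) * (2 * 1)"
      by (intro mult_left_mono) auto
    finally show ?thesis by simp
  qed
  obtain s where "(\<forall>n. simple_function unit_interval (s n)) \<and> (\<forall>n t. 0 \<le> s n t \<and> s n t \<le> r n t)
      \<and> (\<forall>n. gbound n * Lp_norm p (\<lambda>t. r n t - s n t) \<le> \<eta> n)"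
    using simple_approximants_exist[where \<delta> = \<eta>, OF \<eta>0] by (rule exE)
  then have s: "\<And>n. simple_function unit_interval (s n)" "\<And>n t. 0 \<le> s n t" "\<And>n t. s n t \<le> r n t"
    "\<And>n. gbound n * Lp_norm p (\<lambda>t. r n t - s n t) \<le> \<eta> n"
    by auto
  have s_meas: "s n \<in> borel_measurable unit_interval" for n
    by (rule borel_measurable_simple_function[OF s(1)])
  have sLp: "s n \<in> Lp p" for n
    by (rule Lp_dominated(1)[OF p r_Lp[of n] s_meas])
       (use s(2,3) in \<open>auto intro!: AE_I2 order_trans[OF s(3) abs_ge_self]\<close>)
  have rsLp: "(\<lambda>t. gbound n * (r n t - s n t)) \<in> Lp p" for n
    by (intro Lp_cmult Lp_diff[OF p r_Lp sLp])
  have bLp: "block N s k x \<in> Lp p" for N k x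
    unfolding block_def[abs_def]
    by (intro Lp_sum(1)[OF p] Lp_cmult Lp_of_real sLp) simp
  have bnLp: "(\<lambda>t. norm (block N s k x t)) \<in> Lp p" for N k x
    using bLp[of N k x] by (auto simp: Lp_def)
  have key: "1 \<le> A + 1/8"
    if N: "strict_mono N" "N 0 = 0" and x: "x \<in> X" "Lp_norm p x = 1"
      and A: "\<And>K. Lp_norm p (\<lambda>t. \<Sum>k<K. norm (block N s k x t)) \<le> A" for N x A
  proof -
    define S where "S m t = (\<Sum>n<m. g n x * of_real (r n t))" for m t
    have SLp: "S m \<in> Lp p" for m
      unfolding S_def[abs_def] by (intro Lp_sum(1)[OF p] term_Lp) simp
    have "(\<lambda>m. Lp_norm p (\<lambda>t. S m t - x t)) \<longlonglongrightarrow> 0"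
      using expansion[OF x(1)] bij_id
      by (auto simp: series_converges_unconditionally_to_def series_converges_to_def S_def)
    then have lim: "(\<lambda>K. Lp_norm p (\<lambda>t. S (N K) t - x t)) \<longlonglongrightarrow> 0"
      using LIMSEQ_subseq_LIMSEQ[OF _ N(1)] by (auto simp: o_def)
    have "Lp_norm p (S (N K)) \<le> A + 1/8" for K
    proof -
      define E where "E t = (\<Sum>n<N K. gbound n * (r n t - s n t))" for t
      have ELp: "E \<in> Lp p" unfolding E_def[abs_def] by (intro Lp_sum(1)[OF p] rsLp) simp
      have BLp: "(\<lambda>t. \<Sum>k<K. norm (block N s k x t)) \<in> Lp p"
        by (intro Lp_sum(1)[OF p] bnLp) simp
      have pw: "norm (S (N K) t) \<le> (\<Sum>k<K. norm (block N s k x t)) + E t" for t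
      proof -
        have "S (N K) t = (\<Sum>n<N K. g n x * of_real (s n t)) + (\<Sum>n<N K. g n x * of_real (r n t - s n t))"
          unfolding S_def by (simp add: sum.distrib[symmetric] distrib_left[symmetric] del: of_real_diff)
            (simp add: algebra_simps)
        also have "(\<Sum>n<N K. g n x * of_real (s n t)) = (\<Sum>k<K. block N s k x t)"
          unfolding block_def using sum_blocks[of N "\<lambda>n. g n x * of_real (s n t)" K] N
          by (simp add: strict_mono_mono)
        finally have "norm (S (N K) t) \<le> norm (\<Sum>k<K. block N s k x t)
            + norm (\<Sum>n<N K. g n x * of_real (r n t - s n t))"
          by (simp only: norm_triangle_ineq)
        also have "norm (\<Sum>n<N K. g n x * of_real (r n t - s n t)) \<le> E t"
          unfolding E_def
        proof (rule sum_norm_le)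
          fix n
          have "norm (g n x * of_real (r n t - s n t)) = norm (g n x) * (r n t - s n t)"
            using s(3)[of n t] by (simp add: norm_mult del: of_real_diff)
          also have "\<dots> \<le> gbound n * (r n t - s n t)"
            using gbound(2)[OF x(1), of n] x(2) s(3)[of n t] by (intro mult_right_mono) auto
          finally show "norm (g n x * of_real (r n t - s n t)) \<le> gbound n * (r n t - s n t)" .
        qed
        also have "norm (\<Sum>k<K. block N s k x t) \<le> (\<Sum>k<K. norm (block N s k x t))"
          by (rule norm_sum)
        finally show ?thesis by simp
      qed
      have "Lp_norm p (S (N K)) \<le> Lp_norm p (\<lambda>t. (\<Sum>k<K. norm (block N s k x t)) + E t)"
        by (rule Lp_dominated(2)[OF p Lp_add[OF p BLp ELp]])
           (use SLp in \<open>auto simp: Lp_def intro!: AE_I2 order_trans[OF pw abs_ge_self]\<close>)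
      also have "\<dots> \<le> Lp_norm p (\<lambda>t. \<Sum>k<K. norm (block N s k x t)) + Lp_norm p E"
        by (rule Lp_norm_triangle[OF p BLp ELp])
      also have "Lp_norm p E \<le> (\<Sum>n<N K. Lp_norm p (\<lambda>t. gbound n * (r n t - s n t)))"
        unfolding E_def[abs_def] by (intro Lp_sum(2)[OF p] rsLp) simp
      also have "\<dots> \<le> (\<Sum>n<N K. \<eta> n)"
        using s(4) gbound(1) by (intro sum_mono) (simp add: Lp_norm_cmult[OF p])
      also have "\<dots> \<le> 1/8" by (rule \<eta>sum)
      finally show ?thesis using A[of K] by simp
    qed
    then have "Lp_norm p x \<le> A + 1/8"
      using x(1) X_Lp by (intro Lp_norm_le_limit[OF p _ SLp lim]) auto
    then show ?thesis using x(2) by simp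
  qed
  have "\<exists>N. strict_mono N \<and> N 0 = 0 \<and> (\<forall>x\<in>X. \<forall>B\<ge>0. Lp_norm p x = 1 \<longrightarrow>
      (\<forall>K. (\<Sum>k<K. Lp_norm p (block N s k x) powr p) \<le> B powr p) \<longrightarrow> 1 \<le> 4 * B)"
  proof (cases "p = 1")
    case True
    have "1 \<le> 4 * B" if x: "x \<in> X" "Lp_norm p x = 1" and B: "0 \<le> B"
      "\<forall>K. (\<Sum>k<K. Lp_norm p (block id s k x) powr p) \<le> B powr p" for x B
    proof -
      have "1 \<le> B + 1/8"
      proof (rule key[OF _ _ x])
        fix K
        have "Lp_norm p (\<lambda>t. \<Sum>k<K. norm (block id s k x t)) \<le> (\<Sum>k<K. Lp_norm p (\<lambda>t. norm (block id s k x t)))"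
          by (intro Lp_sum(2)[OF p] bnLp) simp
        also have "\<dots> = (\<Sum>k<K. Lp_norm p (block id s k x) powr p)"
          using True by (simp add: Lp_norm_def)
        also have "\<dots> \<le> B" using B True by (metis powr_one)
        finally show "Lp_norm p (\<lambda>t. \<Sum>k<K. norm (block id s k x t)) \<le> B" .
      qed (auto simp: strict_mono_def)
      then show ?thesis using B(1) by simp
    qed
    then show ?thesis by (intro exI[of _ id]) (auto simp: strict_mono_def)
  next
    case False
    then have p1: "1 < p" using p by simp
    obtain N where N: "strict_mono N" "N 0 = 0" and small: "\<And>k x L. x \<in> X \<Longrightarrow> Lp_norm p x = 1 \<Longrightarrow>
        Lp_norm p (\<lambda>t. min (\<Sum>n<N k. gbound n * r n t) (modulus_sum {N (Suc k)..<L} x t)) \<le> \<eta> k"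
      using blocks_exist[where \<eta> = \<eta>, OF p1 \<eta>0] by (elim exE conjE) blast
    have "1 \<le> 4 * B" if x: "x \<in> X" "Lp_norm p x = 1" and B: "0 \<le> B"
      "\<forall>K. (\<Sum>k<K. Lp_norm p (block N s k x) powr p) \<le> B powr p" for x B
    proof -
      define u where "u k t = norm (block N s k x t)" for k t
      have uLp: "u k \<in> Lp p" for k unfolding u_def[abs_def] by (rule bnLp)
      have u0: "0 \<le> u k t" for k t by (simp add: u_def)
      have u_meas [measurable]: "u k \<in> borel_measurable unit_interval" for k
        using uLp[of k] by (simp add: Lp_def)
      have u_le: "u k t \<le> (\<Sum>n=N k..<N (Suc k). norm (g n x) * r n t)" for k t
        unfolding u_def block_def
      proof (rule sum_norm_le)
        fix n
        have "norm (g n x * of_real (s n t)) = norm (g n x) * s n t"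
          using s(2)[of n t] by (simp add: norm_mult)
        also have "\<dots> \<le> norm (g n x) * r n t" by (intro mult_left_mono s(3)) simp
        finally show "norm (g n x * of_real (s n t)) \<le> norm (g n x) * r n t" .
      qed
      have inter: "(\<lambda>t. min (u k t) (\<Sum>j<k-1. u j t)) \<in> Lp p \<and>
          Lp_norm p (\<lambda>t. min (u k t) (\<Sum>j<k-1. u j t)) \<le> \<eta> (k-1)" for k
      proof (cases k)
        case 0
        have "(\<lambda>t. min (u 0 t) (\<Sum>j<0-1. u j t)) = (\<lambda>t. 0)" by (rule ext) (simp add: u0 min_absorb2)
        then show ?thesis using 0 \<eta>0[of 0] by (simp add: less_imp_le)
      next
        case (Suc i)
        define H where "H t = min (\<Sum>n<N i. gbound n * r n t) (modulus_sum {N (Suc i)..<N (Suc (Suc i))} x t)" for t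
        have le: "min (u (Suc i) t) (\<Sum>j<i. u j t) \<le> H t" for t
        proof -
          have "(\<Sum>j<i. u j t) \<le> (\<Sum>j<i. \<Sum>n=N j..<N (Suc j). norm (g n x) * r n t)"
            by (intro sum_mono u_le)
          also have "\<dots> = (\<Sum>n<N i. norm (g n x) * r n t)"
            using N by (intro sum_blocks) (auto simp: strict_mono_mono)
          also have "\<dots> \<le> (\<Sum>n<N i. gbound n * r n t)"
            using gbound(2)[OF x(1)] x(2) by (intro sum_mono mult_right_mono r_nonneg) auto
          finally have "(\<Sum>j<i. u j t) \<le> (\<Sum>n<N i. gbound n * r n t)" .
          moreover have "u (Suc i) t \<le> modulus_sum {N (Suc i)..<N (Suc (Suc i))} x t"
            unfolding modulus_sum_def by (rule u_le)
          ultimately show ?thesis unfolding H_def by auto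
        qed
        have ge: "0 \<le> min (u (Suc i) t) (\<Sum>j<i. u j t)" for t
          using u0 by (simp add: sum_nonneg)
        have HLp: "H \<in> Lp p"
        proof (rule Lp_dominated(1)[OF p modulus_sum_Lp])
          have [measurable]: "r n \<in> borel_measurable unit_interval" for n using r_Lp[of n] by (simp add: Lp_def)
          have [measurable]: "modulus_sum F x \<in> borel_measurable unit_interval" for F
            unfolding modulus_sum_def[abs_def] by measurable
          show "H \<in> borel_measurable unit_interval" unfolding H_def[abs_def] by measurable
          show "AE t in unit_interval. norm (H t) \<le> norm (modulus_sum {N (Suc i)..<N (Suc (Suc i))} x t)"
            using order_trans[OF ge le] by (intro AE_I2) (simp add: H_def modulus_sum_nonneg)
        qed simp
        have meas: "(\<lambda>t. min (u (Suc i) t) (\<Sum>j<i. u j t)) \<in> borel_measurable unit_interval"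
          by measurable
        have dom: "AE t in unit_interval. norm (min (u (Suc i) t) (\<Sum>j<i. u j t)) \<le> norm (H t)"
          using ge le by (intro AE_I2) (metis order_trans real_norm_def abs_of_nonneg)
        show ?thesis
          using Lp_dominated[OF p HLp meas dom] small[OF x, of i "N (Suc (Suc i))"] Suc
          by (simp add: H_def[abs_def])
      qed
      have "1 \<le> (2 * B + 1/4) + 1/8"
      proof (rule key[OF N x])
        fix K
        define m where "m t = (\<Sum>k<K. u k t powr p) powr (1 / p)" for t
        have m0: "0 \<le> m t" for t by (simp add: m_def)
        have mp: "m t powr p = (\<Sum>k<K. u k t powr p)" for t
          unfolding m_def using p by (simp add: powr_powr sum_nonneg)
        have um: "u k t \<le> m t" if "k < K" for k t
        proof -
          have "u k t powr p \<le> (\<Sum>k<K. u k t powr p)"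
            using that by (intro member_le_sum) auto
          then have "(u k t powr p) powr (1 / p) \<le> m t"
            unfolding m_def using p by (intro powr_mono2) auto
          then show ?thesis using p u0 by (simp add: powr_powr)
        qed
        have intu: "integrable unit_interval (\<lambda>t. u k t powr p)" for k
          using Lp_integrable[OF uLp[of k]] u0 by simp
        have mLp: "m \<in> Lp p"
        proof -
          have "m \<in> borel_measurable unit_interval" unfolding m_def[abs_def] by measurable
          moreover have "integrable unit_interval (\<lambda>t. norm (m t) powr p)"
            using m0 intu by (simp add: mp)
          ultimately show ?thesis by (simp add: Lp_def)
        qed
        have mB: "Lp_norm p m \<le> B"
        proof -
          have "(\<integral>t. norm (m t) powr p \<partial>unit_interval) = (\<Sum>k<K. \<integral>t. u k t powr p \<partial>unit_interval)"
            using m0 intu by (simp add: mp)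
          also have "\<dots> = (\<Sum>k<K. Lp_norm p (block N s k x) powr p)"
            unfolding Lp_norm_powr[OF p] u_def ..
          finally show ?thesis using B by (simp add: Lp_norm_le_iff[OF p])
        qed
        define W where "W t = (\<Sum>k<K. min (u k t) (\<Sum>j<k-1. u j t))" for t
        have WLp: "W \<in> Lp p" unfolding W_def[abs_def] using inter by (intro Lp_sum(1)[OF p]) auto
        have W: "Lp_norm p W \<le> 1/4"
        proof -
          have "Lp_norm p W \<le> (\<Sum>k<K. Lp_norm p (\<lambda>t. min (u k t) (\<Sum>j<k-1. u j t)))"
            unfolding W_def[abs_def] using inter by (intro Lp_sum(2)[OF p]) auto
          also have "\<dots> \<le> (\<Sum>k<K. \<eta> (k-1))" using inter by (intro sum_mono) auto
          also have "\<dots> \<le> (\<Sum>k<Suc K. \<eta> (k-1))" using \<eta>0 by (simp add: less_imp_le)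
          also have "\<dots> = \<eta> 0 + (\<Sum>k<K. \<eta> k)" by (subst sum.lessThan_Suc_shift) simp
          also have "\<dots> \<le> 1/16 + 1/8" by (intro add_mono \<eta>sum) (simp add: \<eta>_def)
          finally show ?thesis by simp
        qed
        have pw: "(\<Sum>k<K. u k t) \<le> 2 * m t + W t" for t
          unfolding W_def by (rule sum_le_max_plus_interaction[OF u0 um m0])
        have "Lp_norm p (\<lambda>t. \<Sum>k<K. u k t) \<le> Lp_norm p (\<lambda>t. 2 * m t + W t)"
        proof (rule Lp_dominated(2)[OF p Lp_add[OF p Lp_cmult[OF mLp] WLp]])
          show "(\<lambda>t. \<Sum>k<K. u k t) \<in> borel_measurable unit_interval" by measurable
          have "0 \<le> (\<Sum>k<K. u k t)" for t using u0 by (simp add: sum_nonneg)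
          then show "AE t in unit_interval. norm (\<Sum>k<K. u k t) \<le> norm (2 * m t + W t)"
            using pw by (intro AE_I2) (metis order_trans real_norm_def abs_of_nonneg)
        qed
        also have "\<dots> \<le> Lp_norm p (\<lambda>t. 2 * m t) + Lp_norm p W"
          by (rule Lp_norm_triangle[OF p Lp_cmult[OF mLp] WLp])
        also have "\<dots> \<le> 2 * B + 1/4"
          using mB W by (simp add: Lp_norm_cmult[OF p])
        finally show "Lp_norm p (\<lambda>t. \<Sum>k<K. norm (block N s k x t)) \<le> 2 * B + 1/4"
          by (simp add: u_def)
      qed
      then show ?thesis by simp
    qed
    then show ?thesis using N by blast
  qed
  then obtain N where N: "strict_mono N" "N 0 = 0" and unit: "\<And>x B. x \<in> X \<Longrightarrow> 0 \<le> B \<Longrightarrow> Lp_norm p x = 1 \<Longrightarrow>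
      (\<forall>K. (\<Sum>k<K. Lp_norm p (block N s k x) powr p) \<le> B powr p) \<Longrightarrow> 1 \<le> 4 * B" by blast
  have "Lp_norm p x \<le> 4 * B" if x: "x \<in> X" and B: "0 \<le> B"
    "\<forall>K. (\<Sum>k<K. Lp_norm p (block N s k x) powr p) \<le> B powr p" for x B
  proof (cases "Lp_norm p x = 0")
    case True
    then show ?thesis using B(1) by simp
  next
    case False
    then have nx: "0 < Lp_norm p x" using Lp_norm_nonneg[of p x] by simp
    define c where "c = 1 / Lp_norm p x"
    have c: "0 < c" using nx by (simp add: c_def)
    define y where "y t = of_real c * x t" for t
    have y: "y \<in> X" unfolding y_def[abs_def] by (rule X_scale[OF x])
    have ny: "Lp_norm p y = 1"
      unfolding y_def[abs_def] Lp_norm_cmult[OF p] using nx by (simp add: c_def norm_divide)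
    have "block N s k y = (\<lambda>t. of_real c * block N s k x t)" for k
      unfolding y_def[abs_def] by (rule ext) (rule block_scale[OF x])
    then have "Lp_norm p (block N s k y) powr p = c powr p * Lp_norm p (block N s k x) powr p" for k
      using c by (simp add: Lp_norm_cmult[OF p] powr_mult)
    then have "(\<Sum>k<K. Lp_norm p (block N s k y) powr p) \<le> (c * B) powr p" for K
      using B(2) by (simp add: powr_mult mult_left_mono flip: sum_distrib_left)
    then have "1 \<le> 4 * (c * B)" using unit[OF y _ ny, of "c * B"] c B(1) by auto
    then show ?thesis using nx by (simp add: c_def field_simps)
  qed
  then show ?thesis using N s(1,2,3) by blast
qed

end

section \<open>Discretization\<close>

text \<open>
  Finitely many simple functions are constant on the cells of a finite partition.  The points \<open>\<tau> i\<close>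
  are representatives of the cells and the weights \<open>\<omega> i\<close> their measures.
\<close>

lemma simple_functions_quadrature:
  fixes s :: "nat \<Rightarrow> real \<Rightarrow> real"
  assumes B: "finite B" and s: "\<And>n. simple_function unit_interval (s n)"
  shows "\<exists>d \<tau> \<omega>. (\<forall>i. 0 \<le> \<omega> i) \<and> (\<forall>\<Phi>::(nat \<Rightarrow> real) \<Rightarrow> real.
    (\<integral>t. \<Phi> (restrict (\<lambda>n. s n t) B) \<partial>unit_interval)
      = (\<Sum>i<(d::nat). \<omega> i * \<Phi> (restrict (\<lambda>n. s n (\<tau> i)) B)))"
proof -
  interpret finite_measure unit_interval by (rule finite_measure_unit_interval)
  have [measurable]: "s n \<in> borel_measurable unit_interval" for n
    by (rule borel_measurable_simple_function[OF s])
  define h where "h t = restrict (\<lambda>n. s n t) B" for t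
  define R where "R = h ` {0<..<1::real}"
  have "R \<subseteq> PiE B (\<lambda>n. s n ` {0<..<1})"
    by (auto simp: R_def h_def)
  moreover have "finite (PiE B (\<lambda>n. s n ` {0<..<1}))"
    using s by (intro finite_PiE B) (auto simp: simple_function_def)
  ultimately have finR: "finite R" by (rule finite_subset)
  define d where "d = card R"
  obtain e where e: "bij_betw e {..<d} R"
    using finR ex_bij_betw_nat_finite[OF finR] by (auto simp: d_def lessThan_atLeast0)
  have "\<exists>t. i < d \<longrightarrow> h t = e i" for i
  proof (cases "i < d")
    case True
    then have "e i \<in> R" using bij_betwE[OF e] by simp
    then show ?thesis by (auto simp: R_def)
  qed simp
  then obtain \<tau> where \<tau>: "\<And>i. i < d \<Longrightarrow> h (\<tau> i) = e i" by metis
  define A where "A v = {t \<in> space unit_interval. \<forall>n\<in>B. s n t = v n}" for v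
  have A: "A v \<in> sets unit_interval" for v
    unfolding A_def using B by measurable
  define \<omega> where "\<omega> i = measure unit_interval (A (e i))" for i
  have quad: "(\<integral>t. \<Phi> (h t) \<partial>unit_interval) = (\<Sum>i<d. \<omega> i * \<Phi> (h (\<tau> i)))" for \<Phi> :: "(nat \<Rightarrow> real) \<Rightarrow> real"
  proof -
    have "(\<integral>t. \<Phi> (h t) \<partial>unit_interval) = (\<integral>t. (\<Sum>v\<in>R. \<Phi> v * indicator (A v) t) \<partial>unit_interval)"
    proof (rule Bochner_Integration.integral_cong[OF refl])
      fix t assume t: "t \<in> space unit_interval"
      then have ht: "h t \<in> R" by (auto simp: R_def)
      have ind: "indicator (A v) t = (if v = h t then 1 else (0::real))" if "v \<in> R" for v
      proof -
        have ext: "v \<in> extensional B" using that by (auto simp: R_def h_def)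
        have "t \<in> A v \<longleftrightarrow> v = h t"
        proof
          assume "t \<in> A v"
          then show "v = h t"
            by (intro extensionalityI[OF ext]) (auto simp: A_def h_def)
        qed (use t in \<open>auto simp: A_def h_def\<close>)
        then show ?thesis by (simp add: indicator_def)
      qed
      have "(\<Sum>v\<in>R. \<Phi> v * indicator (A v) t) = (\<Sum>v\<in>R. if v = h t then \<Phi> v else 0)"
        by (intro sum.cong refl) (simp add: ind)
      then show "\<Phi> (h t) = (\<Sum>v\<in>R. \<Phi> v * indicator (A v) t)"
        using ht finR by simp
    qed
    also have "\<dots> = (\<Sum>v\<in>R. \<Phi> v * measure unit_interval (A v))"
    proof -
      have "integrable unit_interval (\<lambda>t. indicator (A v) t :: real)" for v
        by (rule integrable_real_indicator[OF A]) (simp add: emeasure_eq_measure)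
      moreover have "A v \<inter> {0<..<1} = A v" for v
        by (auto simp: A_def)
      ultimately show ?thesis by (subst Bochner_Integration.integral_sum) auto
    qed
    also have "\<dots> = (\<Sum>i<d. \<Phi> (e i) * measure unit_interval (A (e i)))"
      by (rule sum.reindex_bij_betw[OF e, symmetric])
    also have "\<dots> = (\<Sum>i<d. \<omega> i * \<Phi> (h (\<tau> i)))"
      by (intro sum.cong refl) (simp add: \<omega>_def \<tau>)
    finally show ?thesis .
  qed
  have "\<forall>i. 0 \<le> \<omega> i" by (simp add: \<omega>_def)
  then show ?thesis using quad unfolding h_def by blast
qed

text \<open>
  The \<open>\<ell>\<^sub>p\<close> sum of finite-dimensional \<open>\<ell>\<^sub>p\<close> spaces of dimensions \<open>d k\<close> sits in \<open>\<ell>\<^sub>p\<close>, with the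
  coordinate \<open>i\<close> of the block \<open>k\<close> stored at \<open>prod_encode (k, i)\<close> and zeros elsewhere.
\<close>

lemma seq_lp_of_blocks:
  fixes a :: "nat \<Rightarrow> 'k::{real_normed_field,euclidean_space}"
  assumes p: "1 \<le> p" and C: "0 \<le> C"
    and I: "\<And>k. (\<Sum>i<d k. norm (a (prod_encode (k, i))) powr p) = I k"
    and outside: "\<And>k i. d k \<le> i \<Longrightarrow> a (prod_encode (k, i)) = 0"
    and bound: "\<And>K. (\<Sum>k<K. I k) \<le> C powr p"
  shows "a \<in> seq_lp p" "seq_lp_norm p a \<le> C" "(\<Sum>k<K. I k) \<le> seq_lp_norm p a powr p"
proof -
  define h where "h m = norm (a m) powr p" for m
  have h0: "0 \<le> h m" for m by (simp add: h_def)
  have Ik: "(\<Sum>i<L. h (prod_encode (k, i))) \<le> I k" for k L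
  proof -
    have "(\<Sum>i<L. h (prod_encode (k, i))) = (\<Sum>i\<in>{..<L} \<inter> {..<d k}. h (prod_encode (k, i)))"
      using outside[of k] by (intro sum.mono_neutral_right) (auto simp: h_def not_less[symmetric])
    also have "\<dots> \<le> (\<Sum>i<d k. h (prod_encode (k, i)))"
      by (rule sum_mono2) (auto simp: h0)
    finally show ?thesis using I by (simp add: h_def)
  qed
  have part: "(\<Sum>m<L. h m) \<le> C powr p" for L
  proof -
    have sub: "{..<L} \<subseteq> prod_encode ` ({..<L} \<times> {..<L})"
    proof
      fix m assume "m \<in> {..<L}"
      obtain k i where ki: "prod_decode m = (k, i)" by (cases "prod_decode m")
      then have m: "m = prod_encode (k, i)" by (metis prod_decode_inverse)
      have "k \<le> m" "i \<le> m" unfolding m by (rule le_prod_encode_1, rule le_prod_encode_2)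
      then show "m \<in> prod_encode ` ({..<L} \<times> {..<L})" using m \<open>m \<in> {..<L}\<close> by auto
    qed
    have "(\<Sum>m<L. h m) \<le> (\<Sum>m\<in>prod_encode ` ({..<L} \<times> {..<L}). h m)"
      by (rule sum_mono2[OF _ sub]) (auto simp: h0)
    also have "\<dots> = (\<Sum>k<L. \<Sum>i<L. h (prod_encode (k, i)))"
      by (subst sum.reindex) (auto intro: inj_on_subset[OF inj_prod_encode] simp: sum.cartesian_product)
    also have "\<dots> \<le> (\<Sum>k<L. I k)" by (intro sum_mono Ik)
    finally show ?thesis using bound[of L] by simp
  qed
  have sm: "summable h" by (rule summableI_nonneg_bounded[OF h0 part])
  then show "a \<in> seq_lp p" by (simp add: seq_lp_def h_def[abs_def])
  have nrm: "seq_lp_norm p a powr p = suminf h"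
    using p suminf_nonneg[OF sm h0] by (simp add: seq_lp_norm_def h_def[abs_def] powr_powr)
  have "suminf h \<le> C powr p" by (rule suminf_le_const[OF sm part])
  then show "seq_lp_norm p a \<le> C"
    unfolding seq_lp_norm_def h_def[abs_def, symmetric]
    using p C suminf_nonneg[OF sm h0] by (subst le_powr_inverse_iff) auto
  have "(\<Sum>k<K. I k) = (\<Sum>k<K. \<Sum>i<d k. h (prod_encode (k, i)))"
    by (simp add: I h_def)
  also have "\<dots> = (\<Sum>ki\<in>Sigma {..<K} (\<lambda>k. {..<d k}). h (prod_encode ki))"
    by (subst sum.Sigma) (auto simp: case_prod_beta)
  also have "\<dots> = (\<Sum>m\<in>prod_encode ` Sigma {..<K} (\<lambda>k. {..<d k}). h m)"
    by (subst sum.reindex) (auto intro: inj_on_subset[OF inj_prod_encode])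
  also have "\<dots> \<le> suminf h"
    by (rule sum_le_suminf[OF sm]) (auto simp: h0)
  finally show "(\<Sum>k<K. I k) \<le> seq_lp_norm p a powr p" by (simp add: nrm)
qed

context nonneg_unconditional_expansion
begin

text \<open>
  The upper estimate holds for every choice of blocks, because the \<open>p\<close>-th power is superadditive on
  non-negative numbers and the block functions are dominated by consecutive pieces of one modulus sum.
\<close>

lemma block_upper_bound:
  assumes N: "strict_mono N" "N 0 = 0" and s: "\<And>n t. 0 \<le> s n t" "\<And>n t. s n t \<le> r n t"
    and s_meas: "\<And>n. s n \<in> borel_measurable unit_interval"
    and K: "\<And>F. finite F \<Longrightarrow> Lp_norm p (modulus_sum F x) \<le> C"
  shows "(\<Sum>k<L. Lp_norm p (block N s k x) powr p) \<le> C powr p"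
proof -
  have C: "0 \<le> C" using K[of "{}"] Lp_norm_nonneg order_trans by blast
  have le: "norm (block N s k x t) \<le> modulus_sum {N k..<N (Suc k)} x t" for k t
    unfolding block_def modulus_sum_def
  proof (rule sum_norm_le)
    fix n
    have "norm (g n x * of_real (s n t)) = norm (g n x) * s n t"
      using s(1)[of n t] by (simp add: norm_mult)
    also have "\<dots> \<le> norm (g n x) * r n t" by (intro mult_left_mono s(2)) simp
    finally show "norm (g n x * of_real (s n t)) \<le> norm (g n x) * r n t" .
  qed
  have bLp: "block N s k x \<in> Lp p" for k
  proof (rule Lp_dominated(1)[OF p modulus_sum_Lp])
    show "block N s k x \<in> borel_measurable unit_interval"
      unfolding block_def[abs_def] using s_meas
      by (intro borel_measurable_sum borel_measurable_times borel_measurable_const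
          measurable_compose[OF s_meas borel_measurable_of_real])
    show "AE t in unit_interval. norm (block N s k x t) \<le> norm (modulus_sum {N k..<N (Suc k)} x t)"
      using order_trans[OF le abs_ge_self] by (intro AE_I2) simp
  qed simp
  have pw: "(\<Sum>k<L. norm (block N s k x t) powr p) \<le> norm (modulus_sum {..<N L} x t) powr p" for t
  proof -
    have "(\<Sum>k<L. norm (block N s k x t) powr p) \<le> (\<Sum>k<L. modulus_sum {N k..<N (Suc k)} x t powr p)"
      using p le by (intro sum_mono powr_mono2) auto
    also have "\<dots> \<le> (\<Sum>k<L. modulus_sum {N k..<N (Suc k)} x t) powr p"
      by (rule sum_powr_le_powr_sum[OF p]) (auto simp: modulus_sum_nonneg)
    also have "(\<Sum>k<L. modulus_sum {N k..<N (Suc k)} x t) = modulus_sum {..<N L} x t"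
      unfolding modulus_sum_def using N by (intro sum_blocks) (auto simp: strict_mono_mono)
    finally show ?thesis by (simp add: modulus_sum_nonneg)
  qed
  have "(\<Sum>k<L. Lp_norm p (block N s k x) powr p)
      = (\<integral>t. (\<Sum>k<L. norm (block N s k x t) powr p) \<partial>unit_interval)"
    unfolding Lp_norm_powr[OF p] by (intro Bochner_Integration.integral_sum[symmetric] Lp_integrable bLp)
  also have "\<dots> \<le> (\<integral>t. norm (modulus_sum {..<N L} x t) powr p \<partial>unit_interval)"
    by (intro integral_mono pw Bochner_Integration.integrable_sum Lp_integrable bLp modulus_sum_Lp) simp
  also have "\<dots> \<le> C powr p"
    using K[of "{..<N L}"] C by (simp add: Lp_norm_le_iff[OF p])
  finally show ?thesis .
qed

text \<open>
  By the two estimates, \<open>x\<close> is mapped isomorphically to the sequence of its block functions in the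
  \<open>\<ell>\<^sub>p\<close> sum of copies of \<open>L\<^sub>p\<close>.  All functions of the block \<open>k\<close> are combinations of finitely many simple
  functions, so their values at the representatives \<open>\<tau> k i\<close>, scaled by the \<open>p\<close>-th roots of
  the measures \<open>\<omega> k i\<close>, give an isometry into a finite-dimensional \<open>\<ell>\<^sub>p\<close> space.
\<close>

theorem embeds_into_seq_lp:
  "\<exists>T. isomorphic_embedding X (Lp_norm p) (seq_lp p) (seq_lp_norm p) T"
proof -
  obtain N s where N: "strict_mono N" "N 0 = 0"
    and s: "\<And>n. simple_function unit_interval (s n)" "\<And>n t. 0 \<le> s n t" "\<And>n t. s n t \<le> r n t"
    and lower: "\<And>x B. x \<in> X \<Longrightarrow> 0 \<le> B \<Longrightarrow>
      (\<forall>K. (\<Sum>k<K. Lp_norm p (block N s k x) powr p) \<le> B powr p) \<Longrightarrow> Lp_norm p x \<le> 4 * B"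
    using block_lower_bound by metis
  obtain C where C: "0 \<le> C"
    "\<And>F x. finite F \<Longrightarrow> x \<in> X \<Longrightarrow> Lp_norm p (modulus_sum F x) \<le> C * Lp_norm p x"
    using modulus_sum_bound by blast
  define B where "B k = {N k..<N (Suc k)}" for k
  define quadrature where "quadrature k d \<tau> \<omega> \<longleftrightarrow> (\<forall>i. 0 \<le> \<omega> i) \<and> (\<forall>\<Phi>::(nat \<Rightarrow> real) \<Rightarrow> real.
      (\<integral>t. \<Phi> (restrict (\<lambda>n. s n t) (B k)) \<partial>unit_interval)
      = (\<Sum>i<(d::nat). \<omega> i * \<Phi> (restrict (\<lambda>n. s n (\<tau> i)) (B k))))" for k d \<tau> \<omega>
  have "\<exists>d \<tau> \<omega>. quadrature k d \<tau> \<omega>" for k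
    unfolding quadrature_def by (rule simple_functions_quadrature[OF _ s(1)]) (simp add: B_def)
  then obtain d \<tau> \<omega> where "\<And>k. quadrature k (d k) (\<tau> k) (\<omega> k)"
    by metis
  then have \<omega>0: "\<And>k i. 0 \<le> \<omega> k i"
    and quad: "\<And>k (\<Phi>::(nat \<Rightarrow> real) \<Rightarrow> real).
      (\<integral>t. \<Phi> (restrict (\<lambda>n. s n t) (B k)) \<partial>unit_interval)
      = (\<Sum>i<d k. \<omega> k i * \<Phi> (restrict (\<lambda>n. s n (\<tau> k i)) (B k)))"
    by (simp_all add: quadrature_def)
  define T where "T x m = (case prod_decode m of (k, i) \<Rightarrow>
    if i < d k then of_real (\<omega> k i powr (1 / p)) * block N s k x (\<tau> k i) else 0)" for x m
  have T_add: "T (\<lambda>t. x t + y t) = (\<lambda>m. T x m + T y m)" if "x \<in> X" "y \<in> X" for x y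
    by (rule ext) (simp add: T_def block_def g_add[OF that] distrib_right distrib_left
        sum.distrib split: prod.split)
  have T_scale: "T (\<lambda>t. c * x t) = (\<lambda>m. c * T x m)" if "x \<in> X" for x c
    by (rule ext) (simp add: T_def block_scale[OF that] mult.left_commute split: prod.split)
  have I: "(\<Sum>i<d k. norm (T x (prod_encode (k, i))) powr p) = Lp_norm p (block N s k x) powr p" for k x
  proof -
    define \<Phi> where "\<Phi> v = norm (\<Sum>n\<in>B k. g n x * of_real (v n)) powr p" for v
    have bl: "\<Phi> (restrict (\<lambda>n. s n t) (B k)) = norm (block N s k x t) powr p" for t
      unfolding \<Phi>_def block_def B_def by simp
    have "(\<Sum>i<d k. norm (T x (prod_encode (k, i))) powr p)
        = (\<Sum>i<d k. \<omega> k i * \<Phi> (restrict (\<lambda>n. s n (\<tau> k i)) (B k)))"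
      unfolding bl using \<omega>0[of k] p
      by (intro sum.cong refl) (simp add: T_def norm_mult powr_mult powr_powr)
    also have "\<dots> = (\<integral>t. \<Phi> (restrict (\<lambda>n. s n t) (B k)) \<partial>unit_interval)"
      by (rule quad[symmetric])
    finally show ?thesis by (simp add: bl Lp_norm_powr[OF p])
  qed
  have outside: "T x (prod_encode (k, i)) = 0" if "d k \<le> i" for x k i
    using that by (simp add: T_def)
  have bnd: "(\<Sum>k<K. Lp_norm p (block N s k x) powr p) \<le> (C * Lp_norm p x) powr p" if "x \<in> X" for x K
    by (rule block_upper_bound[OF N s(2,3) borel_measurable_simple_function[OF s(1)] C(2)[OF _ that]])
  have C0: "0 \<le> C * Lp_norm p x" for x using C(1) Lp_norm_nonneg[of p x] by simp
  note blocks = seq_lp_of_blocks[where a = "T x" and d = d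
      and I = "\<lambda>k. Lp_norm p (block N s k x) powr p" and C = "C * Lp_norm p x" for x, OF p C0 I outside bnd]
  have T_mem: "T x \<in> seq_lp p" if "x \<in> X" for x using blocks(1)[OF _ that] by blast
  have upper: "seq_lp_norm p (T x) \<le> C * Lp_norm p x" if "x \<in> X" for x using blocks(2)[OF _ that] by blast
  have low: "Lp_norm p x \<le> 4 * seq_lp_norm p (T x)" if "x \<in> X" for x
    using blocks(3)[OF _ that] by (intro lower[OF that]) (auto simp: seq_lp_norm_def)
  have diff: "(\<lambda>m. T y m - T x m) = T (\<lambda>t. y t - x t)" if "x \<in> X" "y \<in> X" for x y
    using T_add[OF that(2) X_scale[OF that(1), of "-1"]] T_scale[OF that(1), of "-1"] by simp
  show ?thesis
    unfolding isomorphic_embedding_def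
  proof (intro exI[of _ T] conjI ballI allI impI)
    show "T ` X \<subseteq> seq_lp p" using T_mem by auto
    show "T (\<lambda>t. x t + y t) = (\<lambda>m. T x m + T y m)" if "x \<in> X" "y \<in> X" for x y using T_add that .
    show "T (\<lambda>t. c * x t) = (\<lambda>m. c * T x m)" if "x \<in> X" for x c using T_scale that .
    fix x and e :: real assume x: "x \<in> X" and e: "0 < e"
    show "\<exists>\<delta>>0. \<forall>y\<in>X. Lp_norm p (\<lambda>t. y t - x t) < \<delta> \<longrightarrow> seq_lp_norm p (\<lambda>m. T y m - T x m) < e"
    proof (intro exI[of _ "e / (C + 1)"] conjI ballI impI)
      show "0 < e / (C + 1)" using e C(1) by simp
      fix y assume y: "y \<in> X" and d: "Lp_norm p (\<lambda>t. y t - x t) < e / (C + 1)"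
      have "seq_lp_norm p (\<lambda>m. T y m - T x m) \<le> C * Lp_norm p (\<lambda>t. y t - x t)"
        unfolding diff[OF x y] by (rule upper[OF X_diff[OF y x]])
      also have "\<dots> \<le> (C + 1) * Lp_norm p (\<lambda>t. y t - x t)"
        by (intro mult_right_mono Lp_norm_nonneg) simp
      also have "\<dots> < e" using d C(1) by (simp add: pos_less_divide_eq mult.commute)
      finally show "seq_lp_norm p (\<lambda>m. T y m - T x m) < e" .
    qed
    show "\<exists>\<delta>>0. \<forall>y\<in>X. seq_lp_norm p (\<lambda>m. T y m - T x m) < \<delta> \<longrightarrow> Lp_norm p (\<lambda>t. y t - x t) < e"
    proof (intro exI[of _ "e / 4"] conjI ballI impI)
      show "0 < e / 4" using e by simp
      fix y assume y: "y \<in> X" and d: "seq_lp_norm p (\<lambda>m. T y m - T x m) < e / 4"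
      show "Lp_norm p (\<lambda>t. y t - x t) < e"
        using low[OF X_diff[OF y x]] d unfolding diff[OF x y] by simp
    qed
  qed
qed

end

section \<open>Closed spans\<close>

lemma lin_span_add:
  assumes "y \<in> lin_span f" "z \<in> lin_span f"
  shows "(\<lambda>t. y t + z t) \<in> lin_span f"
proof -
  obtain n c m c' where y: "y = (\<lambda>t. \<Sum>k<n. c k * f k t)" and z: "z = (\<lambda>t. \<Sum>k<m. c' k * f k t)"
    using assms by (auto simp: lin_span_def)
  have pad: "(\<Sum>k<j. a k * f k t) = (\<Sum>k<max n m. (if k < j then a k else 0) * f k t)" if "j \<le> max n m" for a j t
    using that by (intro sum.mono_neutral_cong_left) auto
  have "(\<lambda>t. y t + z t) = (\<lambda>t. \<Sum>k<max n m.
      ((if k < n then c k else 0) + (if k < m then c' k else 0)) * f k t)"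
    unfolding y z by (rule ext) (subst (1 2) pad, simp, simp, simp add: distrib_right sum.distrib)
  then show ?thesis
    unfolding lin_span_def
    by (intro CollectI exI[of _ "max n m"]
        exI[of _ "\<lambda>k. (if k < n then c k else 0) + (if k < m then c' k else 0)"]) simp
qed

lemma lin_span_scale:
  assumes "y \<in> lin_span f"
  shows "(\<lambda>t. a * y t) \<in> lin_span f"
proof -
  obtain n c where y: "y = (\<lambda>t. \<Sum>k<n. c k * f k t)" using assms by (auto simp: lin_span_def)
  have "(\<lambda>t. a * y t) = (\<lambda>t. \<Sum>k<n. (a * c k) * f k t)"
    unfolding y by (simp add: sum_distrib_left mult.assoc)
  then show ?thesis unfolding lin_span_def by (intro CollectI exI[of _ n] exI[of _ "\<lambda>k. a * c k"]) simp
qed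

theorem theorem3:
  fixes p :: real
    and f :: "nat \<Rightarrow> real \<Rightarrow> 'k::{real_normed_field,euclidean_space}"
    and g :: "nat \<Rightarrow> (real \<Rightarrow> 'k) \<Rightarrow> 'k"
  assumes "1 \<le> p"
    and "unconditionally_quasibasic (Lp p) (Lp_norm p) f g"
    and "\<And>n. AE t in lebesgue_on {0<..<1}. f n t \<in> \<real>\<^sub>\<ge>\<^sub>0"
  shows "\<exists>T :: (real \<Rightarrow> 'k) \<Rightarrow> (nat \<Rightarrow> 'k).
    isomorphic_embedding (closed_span (Lp p) (Lp_norm p) f) (Lp_norm p)
      (seq_lp p) (seq_lp_norm p) T"
proof -
  note p = \<open>1 \<le> p\<close>
  define X where "X = closed_span (Lp p) (Lp_norm p) f"
  define r where "r n t = norm (f n t)" for n t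
  have fLp: "f n \<in> Lp p" and dual: "g n \<in> dual_space (Lp p) (Lp_norm p)" for n
    using assms(2) by (auto simp: unconditionally_quasibasic_def)
  have exp: "series_converges_unconditionally_to (Lp_norm p) (\<lambda>n t. g n x * f n t) x" if "x \<in> X" for x
    using assms(2) that
    by (simp add: unconditionally_quasibasic_def unconditional_quasibasis_def X_def)
  have X_Lp: "X \<subseteq> Lp p" by (auto simp: X_def closed_span_def)
  have span_Lp: "lin_span f \<subseteq> Lp p"
    by (auto simp: lin_span_def intro!: Lp_sum(1)[OF p] Lp_cmult fLp)
  have XI: "x \<in> X" if "x \<in> Lp p" "\<And>e. 0 < e \<Longrightarrow> \<exists>y\<in>lin_span f. Lp_norm p (\<lambda>t. x t - y t) < e" for x
    using that by (simp add: X_def closed_span_def)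
  have XD: "\<exists>y\<in>lin_span f. Lp_norm p (\<lambda>t. x t - y t) < e" if "x \<in> X" "0 < e" for x e
    using that by (simp add: X_def closed_span_def)
  \<comment> \<open>A non-negative scalar is the image of its own norm.\<close>
  have same: "AE t in unit_interval. \<forall>n. f n t = of_real (r n t)"
  proof -
    have "AE t in unit_interval. f n t = of_real (r n t)" for n
      using assms(3)[of n] by eventually_elim (auto simp: r_def nonneg_Reals_def)
    then show ?thesis by (simp add: AE_all_countable)
  qed
  have rLp: "r n \<in> Lp p" for n
    using fLp[of n] by (auto simp: r_def[abs_def] Lp_def)
  have g_lin: "\<And>n x y. x \<in> Lp p \<Longrightarrow> y \<in> Lp p \<Longrightarrow> g n (\<lambda>t. x t + y t) = g n x + g n y"
    "\<And>n c x. x \<in> Lp p \<Longrightarrow> g n (\<lambda>t. c * x t) = c * g n x"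
    using dual by (simp_all add: dual_space_def)
  interpret nonneg_unconditional_expansion p X r g
  proof
    show "1 \<le> p" by (rule p)
    show "X \<subseteq> Lp p" by (rule X_Lp)
    show "(\<lambda>t. 0) \<in> X"
    proof (rule XI)
      have "(\<lambda>t. 0) \<in> lin_span f" unfolding lin_span_def by (intro CollectI exI[of _ 0]) simp
      then show "\<exists>y\<in>lin_span f. Lp_norm p (\<lambda>t. 0 - y t) < e" if "0 < e" for e
        using that by (intro bexI[of _ "\<lambda>t. 0"]) auto
    qed simp
    show "(\<lambda>t. x t + y t) \<in> X" if x: "x \<in> X" and y: "y \<in> X" for x y
    proof (rule XI)
      show "(\<lambda>t. x t + y t) \<in> Lp p" using x y X_Lp by (intro Lp_add p) auto
      fix e :: real assume "0 < e"
      then obtain v w where v: "v \<in> lin_span f" "Lp_norm p (\<lambda>t. x t - v t) < e/2"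
        and w: "w \<in> lin_span f" "Lp_norm p (\<lambda>t. y t - w t) < e/2"
        using XD[OF x, of "e/2"] XD[OF y, of "e/2"] by auto
      have "Lp_norm p (\<lambda>t. (x t - v t) + (y t - w t)) \<le> Lp_norm p (\<lambda>t. x t - v t) + Lp_norm p (\<lambda>t. y t - w t)"
        using x y v(1) w(1) X_Lp span_Lp by (intro Lp_norm_triangle Lp_diff p) auto
      also have "(\<lambda>t. (x t - v t) + (y t - w t)) = (\<lambda>t. (x t + y t) - (v t + w t))"
        by (simp add: algebra_simps)
      finally have "Lp_norm p (\<lambda>t. (x t + y t) - (v t + w t)) < e"
        using v(2) w(2) by simp
      then show "\<exists>z\<in>lin_span f. Lp_norm p (\<lambda>t. (x t + y t) - z t) < e"
        using lin_span_add[OF v(1) w(1)] by (intro bexI[of _ "\<lambda>t. v t + w t"]) auto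
    qed
    show "(\<lambda>t. c * x t) \<in> X" if x: "x \<in> X" for c x
    proof (rule XI)
      show "(\<lambda>t. c * x t) \<in> Lp p" using x X_Lp by (intro Lp_cmult) auto
      fix e :: real assume "0 < e"
      have pos: "0 < norm c + 1" by (simp add: add_nonneg_pos)
      then obtain v where v: "v \<in> lin_span f" "Lp_norm p (\<lambda>t. x t - v t) < e / (norm c + 1)"
        using XD[OF x, of "e / (norm c + 1)"] \<open>0 < e\<close> by auto
      have "Lp_norm p (\<lambda>t. c * x t - c * v t) = norm c * Lp_norm p (\<lambda>t. x t - v t)"
        by (simp add: Lp_norm_cmult[OF p] flip: right_diff_distrib)
      also have "\<dots> \<le> (norm c + 1) * Lp_norm p (\<lambda>t. x t - v t)"
        by (intro mult_right_mono Lp_norm_nonneg) simp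
      also have "\<dots> < e" using v(2) pos by (simp add: pos_less_divide_eq mult.commute)
      finally show "\<exists>z\<in>lin_span f. Lp_norm p (\<lambda>t. c * x t - z t) < e"
        using lin_span_scale[OF v(1)] by (intro bexI[of _ "\<lambda>t. c * v t"]) auto
    qed
    show "x \<in> X" if x: "x \<in> Lp p" and approx: "\<And>e. 0 < e \<Longrightarrow> \<exists>y\<in>X. Lp_norm p (\<lambda>t. x t - y t) < e" for x
    proof (rule XI[OF x])
      fix e :: real assume "0 < e"
      then obtain y where y: "y \<in> X" "Lp_norm p (\<lambda>t. x t - y t) < e/2" using approx[of "e/2"] by auto
      obtain z where z: "z \<in> lin_span f" "Lp_norm p (\<lambda>t. y t - z t) < e/2"
        using XD[OF y(1), of "e/2"] \<open>0 < e\<close> by auto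
      have "Lp_norm p (\<lambda>t. x t - z t) \<le> Lp_norm p (\<lambda>t. x t - y t) + Lp_norm p (\<lambda>t. y t - z t)"
        using x y(1) z(1) X_Lp span_Lp by (intro Lp_norm_diff_triangle p) auto
      then show "\<exists>z\<in>lin_span f. Lp_norm p (\<lambda>t. x t - z t) < e" using y(2) z by (intro bexI[of _ z]) auto
    qed
    show "r n \<in> Lp p" for n by (rule rLp)
    show "0 \<le> r n t" for n t by (simp add: r_def)
    show "g n (\<lambda>t. x t + y t) = g n x + g n y" if "x \<in> X" "y \<in> X" for n x y
      using g_lin(1) that X_Lp by (simp add: subset_iff)
    show "g n (\<lambda>t. c * x t) = c * g n x" if "x \<in> X" for n c x
      using g_lin(2) that X_Lp by (simp add: subset_iff)
    show "\<exists>C. \<forall>x\<in>X. norm (g n x) \<le> C * Lp_norm p x" for n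
    proof -
      obtain C where "\<forall>x\<in>Lp p. norm (g n x) \<le> C * Lp_norm p x"
        using dual[of n] by (auto simp: dual_space_def)
      then show ?thesis using X_Lp by (intro exI[of _ C]) (simp add: subset_iff)
    qed
    show "series_converges_unconditionally_to (Lp_norm p) (\<lambda>n t. g n x * of_real (r n t)) x"
      if x: "x \<in> X" for x
      unfolding series_converges_unconditionally_to_def series_converges_to_def
    proof (intro allI impI)
      fix \<pi> :: "nat \<Rightarrow> nat" assume "bij \<pi>"
      then have lim: "(\<lambda>n. Lp_norm p (\<lambda>t. (\<Sum>k<n. g (\<pi> k) x * f (\<pi> k) t) - x t)) \<longlonglongrightarrow> 0"
        using exp[OF x] by (simp add: series_converges_unconditionally_to_def series_converges_to_def)
      have "Lp_norm p (\<lambda>t. (\<Sum>k<n. g (\<pi> k) x * of_real (r (\<pi> k) t)) - x t)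
          = Lp_norm p (\<lambda>t. (\<Sum>k<n. g (\<pi> k) x * f (\<pi> k) t) - x t)" for n
      proof (rule Lp_norm_cong_AE)
        show "AE t in unit_interval. norm ((\<Sum>k<n. g (\<pi> k) x * of_real (r (\<pi> k) t)) - x t)
            = norm ((\<Sum>k<n. g (\<pi> k) x * f (\<pi> k) t) - x t)"
          using same by eventually_elim simp
        have "(\<lambda>t. of_real (r k t) :: 'k) \<in> Lp p" for k
          by (rule Lp_of_real[OF rLp])
        then have "(\<lambda>t. (\<Sum>k<n. g (\<pi> k) x * of_real (r (\<pi> k) t)) - x t) \<in> Lp p"
          using x X_Lp by (intro Lp_diff[OF p] Lp_sum(1)[OF p] Lp_cmult) auto
        then show "(\<lambda>t. (\<Sum>k<n. g (\<pi> k) x * of_real (r (\<pi> k) t)) - x t) \<in> borel_measurable unit_interval"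
          by (simp add: Lp_def)
        have "(\<lambda>t. (\<Sum>k<n. g (\<pi> k) x * f (\<pi> k) t) - x t) \<in> Lp p"
          using x X_Lp fLp by (intro Lp_diff[OF p] Lp_sum(1)[OF p] Lp_cmult) auto
        then show "(\<lambda>t. (\<Sum>k<n. g (\<pi> k) x * f (\<pi> k) t) - x t) \<in> borel_measurable unit_interval"
          by (simp add: Lp_def)
      qed
      then show "(\<lambda>n. Lp_norm p (\<lambda>t. (\<Sum>k<n. ((\<lambda>n t. g n x * of_real (r n t)) \<circ> \<pi>) k t) - x t)) \<longlonglongrightarrow> 0"
        using lim by simp
    qed
  qed
  show ?thesis using embeds_into_seq_lp by (simp add: X_def)
qed

end
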